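(* Let $h(s)$ be a meromorphic function on $\mathbb{C}$ with no zeros in $\mathrm{Re}(s)>1/2$ except for at most finitely many zeros $\sigma_1,\dots,\sigma_n$ lying in the real interval $(1/2,\infty)$, the largest being $\sigma_n$. Suppose also that $h(s)$ is real-valued on $\mathbb{R}$ and that $c_s:=\frac{h(1-s)}{h(s)}$ satisfies $c_s\ll |s|^{1-\epsilon}$ uniformly away from poles in $\mathrm{Re}(s)\geq 1/2$, for some $\epsilon>0$. (i) If $\mathrm{Res}_{s=\sigma_i}c_s\geq 0$ for all $i$ and $1+c_s$ is not square-integrable on the critical line $1/2+i\mathbb{R}$, then, except for simultaneous zeros of $h(s)$ and $h(1-s)$ (if any), the only zeros of $1+c_s$ lie on the critical line $\mathrm{Re}(s)=1/2$ or on the real interval $[1-\sigma_n,\sigma_n]$. (ii) If $\mathrm{Res}_{s=\sigma_i}c_s\leq 0$ for all $i$ and $1-c_s$ is not square-integrable on the critical line, then, except for simultaneous zeros of $h(s)$ and $h(1-s)$ (if any), the only zeros of $1-c_s$ lie on the critical line or on the real interval $[1-\sigma_n,\sigma_n]$. In either case, all of these zeros are simple, except possibly the zero at $s=1/2$.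
   Formalization: The formal statement additionally assumes that every pole of c_s in Re(s)>1/2 is one of the zeros σ_i of h and is simple; without this the claim fails (e.g. h=(u²+2u+2)/(u²+2u+5) with u=s−1/2). *)

theory Defs
  imports "HOL-Complex_Analysis.Complex_Analysis"
begin

(* A zero of a nicely meromorphic function; such a function also takes the value 0 at its poles. *)
definition mero_zero :: "(complex \<Rightarrow> complex) \<Rightarrow> complex \<Rightarrow> bool" where
  "mero_zero f s \<longleftrightarrow> \<not> is_pole f s \<and> f s = 0"

(* The quotient as a meromorphic function: remove_sings gives it its limit at every removable
   singularity and the value 0 at every pole, instead of the junk value of the pointwise quotient. *)
definition c_quot :: "(complex \<Rightarrow> complex) \<Rightarrow> complex \<Rightarrow> complex" where
  "c_quot h = remove_sings (\<lambda>s. h (1 - s) / h s)"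

definition square_integrable_critical_line :: "(complex \<Rightarrow> complex) \<Rightarrow> bool" where
  "square_integrable_critical_line f \<longleftrightarrow>
     (\<lambda>t::real. f (Complex (1/2) t)) \<in> borel_measurable lborel \<and>
     integrable lborel (\<lambda>t::real. (cmod (f (Complex (1/2) t)))\<^sup>2)"

end

theory Submission
  imports Defs
begin

text \<open>
  Put \<open>w = s - 1/2\<close> and \<open>F w = \<plusminus> c\<^sub>s\<close>, so that \<open>F w * F (- w) = 1\<close>, \<open>F\<close> is unimodular on the imaginary
  axis, and its only singularities with \<open>Re w \<ge> 0\<close> are simple poles at points \<open>p > 0\<close> with residues
  \<open>\<rho> p \<ge> 0\<close>. On the axis \<open>\<bar>1 + F\<bar>\<^sup>2 = (1 + F w) + (1 + F (- w))\<close>; integrating this against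
  \<open>1 / (t\<^sup>2 + w\<^sup>2)\<close> and closing the contour to the right, where the growth bound kills the
  semicircle, gives
  \<open>2 \<pi> (1 + F w) / w = \<integral> \<bar>1 + F (i t)\<bar>\<^sup>2 / (t\<^sup>2 + w\<^sup>2) dt + 4 \<pi> (\<Sum>p. \<rho> p / (w\<^sup>2 - p\<^sup>2))\<close>.
  As a function of \<open>w\<^sup>2\<close> the right-hand side is a Stieltjes transform of a positive measure on the
  real line, which is nonzero because \<open>1 + F\<close> does not vanish identically on the axis. Hence the
  imaginary part of the right-hand side is at least a constant times \<open>\<bar>Im (w\<^sup>2)\<bar>\<close> in modulus, locally
  uniformly up to the axis. So zeros off the axis are real, and a multiple zero \<open>w \<noteq> 0\<close>, on the axis
  or not, would violate the lower bound. For real \<open>w\<close> beyond all \<open>p\<close> the right-hand side is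
  positive. Zeros with \<open>Re s < 1/2\<close> are reflections of zeros with \<open>Re s > 1/2\<close>.
\<close>

section \<open>Integrals over the imaginary axis against 1/(t^2 + w^2), and their positivity\<close>

lemma of_real_square_add_square:
  "of_real t ^ 2 + w ^ 2 = (w + \<i> * of_real t) * (w - \<i> * of_real t)"
  by (simp add: algebra_simps power2_eq_square)

lemma of_real_square_add_square_nonzero:
  assumes "Re w > 0"
  shows "of_real t ^ 2 + w ^ 2 \<noteq> 0"
proof -
  have "w + \<i> * of_real t \<noteq> 0" "w - \<i> * of_real t \<noteq> 0"
    using assms by (auto simp: complex_eq_iff)
  thus ?thesis by (simp add: of_real_square_add_square)
qed

text \<open>Partial fractions give the antiderivative \<open>L\<close>; the principal branch is safe
  because w + it and w - it stay in the right half-plane. Scaling R out of both logarithms cancels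
  ln R and leaves Ln i - Ln (-i) = i pi in the limit.\<close>

lemma integral_inverse_quadratic_limit:
  fixes w :: complex
  assumes "Re w > 0"
  shows "((\<lambda>R. integral {-R..R} (\<lambda>t. 1 / (of_real t ^ 2 + w ^ 2))) \<longlongrightarrow> pi / w) at_top"
proof -
  have w0: "w \<noteq> 0" using assms by auto
  define L where "L t = (Ln (w + \<i> * of_real t) - Ln (w - \<i> * of_real t)) / (2 * \<i> * w)" for t :: real
  have nz: "w + \<i> * of_real t \<noteq> 0" "w - \<i> * of_real t \<noteq> 0" for t
    using assms by (auto simp: complex_eq_iff)
  have slit: "w + \<i> * of_real t \<notin> \<real>\<^sub>\<le>\<^sub>0" "w - \<i> * of_real t \<notin> \<real>\<^sub>\<le>\<^sub>0" for t
    using assms by (auto simp: complex_nonpos_Reals_iff)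
  have der: "(L has_vector_derivative 1 / (of_real t ^ 2 + w ^ 2)) (at t within S)" for t S
  proof -
    have "((\<lambda>z. (Ln (w + \<i> * z) - Ln (w - \<i> * z)) / (2 * \<i> * w)) has_field_derivative
            (\<i> / (w + \<i> * of_real t) - (- \<i>) / (w - \<i> * of_real t)) / (2 * \<i> * w)) (at (of_real t))"
      using slit[of t] w0 by (auto intro!: derivative_eq_intros simp: field_simps)
    from has_vector_derivative_real_field[OF this]
    have "(L has_vector_derivative
            (\<i> / (w + \<i> * of_real t) - (- \<i>) / (w - \<i> * of_real t)) / (2 * \<i> * w)) (at t within S)"
      unfolding L_def[abs_def] .
    moreover have "(\<i> / (w + \<i> * of_real t) - (- \<i>) / (w - \<i> * of_real t)) / (2 * \<i> * w)
                     = 1 / (of_real t ^ 2 + w ^ 2)"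
      unfolding of_real_square_add_square
      using nz[of t] w0 by (simp add: divide_simps) (simp add: algebra_simps)
    ultimately show ?thesis by simp
  qed
  have int: "integral {-R..R} (\<lambda>t. 1 / (of_real t ^ 2 + w ^ 2))
     = (Ln (w / of_real R + \<i>) - Ln (w / of_real R - \<i>)) / (\<i> * w)" if "R > 0" for R :: real
  proof -
    have nzR: "w / of_real R + \<i> \<noteq> 0" "w / of_real R - \<i> \<noteq> 0"
      using assms that by (auto simp: complex_eq_iff)
    have "((\<lambda>t. 1 / (of_real t ^ 2 + w ^ 2)) has_integral (L R - L (-R))) {-R..R}"
      using that by (intro fundamental_theorem_of_calculus der) auto
    hence "integral {-R..R} (\<lambda>t. 1 / (of_real t ^ 2 + w ^ 2)) = L R - L (-R)"
      by (rule integral_unique)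
    also have "\<dots> = (Ln (w + \<i> * of_real R) - Ln (w - \<i> * of_real R)) / (\<i> * w)"
      using w0 by (simp add: L_def field_simps)
    also have "Ln (w + \<i> * of_real R) = Ln (of_real R * (w / of_real R + \<i>))"
      using that by (simp add: algebra_simps)
    also have "\<dots> = of_real (ln R) + Ln (w / of_real R + \<i>)"
      using nzR that by (simp add: Ln_times_of_real Ln_of_real)
    also have "Ln (w - \<i> * of_real R) = Ln (of_real R * (w / of_real R - \<i>))"
      using that by (simp add: algebra_simps)
    also have "\<dots> = of_real (ln R) + Ln (w / of_real R - \<i>)"
      using nzR that by (simp add: Ln_times_of_real Ln_of_real)
    finally show ?thesis by simp
  qed
  have lim0: "((\<lambda>R. w / complex_of_real R) \<longlongrightarrow> 0) at_top"
    by (intro tendsto_divide_0[OF tendsto_const] filterlim_compose[OF filterlim_of_real_at_infinity]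
          filterlim_at_top_imp_at_infinity filterlim_ident)
  have "((\<lambda>R. (Ln (w / complex_of_real R + \<i>) - Ln (w / complex_of_real R - \<i>)) / (\<i> * w))
          \<longlongrightarrow> (Ln (0 + \<i>) - Ln (0 - \<i>)) / (\<i> * w)) at_top"
    using w0 by (intro tendsto_intros lim0) (auto simp: complex_nonpos_Reals_iff)
  also have "(Ln (0 + \<i>) - Ln (0 - \<i>)) / (\<i> * w) = pi / w"
    using w0 by (simp add: field_simps)
  finally show ?thesis
    by (rule Lim_transform_eventually) (use eventually_gt_at_top[of 0] in \<open>eventually_elim, simp add: int\<close>)
qed

text \<open>On the axis the integrand is f(w0)/(t^2 + w0^2) minus \<open>\<phi>\<close>, where
  \<open>\<phi>\<close> is the quotient (f w - f w0)/(w^2 - w0^2) with its singularity at w0 filled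
  in. The first term is the integral just computed. The second tends to 0: \<open>\<phi>\<close> has
  a primitive on the half-plane, so the segment may be replaced by a semicircle of length pi R, on
  which \<open>\<phi>\<close> is o(1/R).\<close>

lemma half_plane_poisson_limit:
  fixes f :: "complex \<Rightarrow> complex"
  assumes f: "f analytic_on {w. Re w \<ge> 0}" and w0: "Re w0 > 0"
    and growth: "\<And>e. e > 0 \<Longrightarrow> \<exists>r. \<forall>w. Re w \<ge> 0 \<and> norm w \<ge> r \<longrightarrow> norm (f w) \<le> e * norm w"
  shows "((\<lambda>R. integral {-R..R} (\<lambda>t. f (\<i> * of_real t) / (of_real t ^ 2 + w0 ^ 2)))
           \<longlongrightarrow> pi * f w0 / w0) at_top"
proof -
  define S where "S = {w. Re w \<ge> 0}"
  define \<phi> where "\<phi> w = (if w = w0 then deriv f w0 else (f w - f w0) / (w - w0)) / (w + w0)" for w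
  have "convex S" unfolding S_def by (simp add: convex_halfspace_Re_ge)
  have w0int: "w0 \<in> interior S"
  proof -
    have "{w. Re w > 0} \<subseteq> interior S"
      by (rule interior_maximal) (auto simp: S_def open_halfspace_Re_gt)
    thus ?thesis using w0 by auto
  qed
  have holf: "f holomorphic_on S"
    using f analytic_imp_holomorphic by (auto simp: S_def)
  have nz: "w + w0 \<noteq> 0" if "w \<in> S" for w
    using that w0 by (auto simp: S_def complex_eq_iff)
  have hol\<phi>: "\<phi> holomorphic_on S"
    unfolding \<phi>_def by (intro holomorphic_intros pole_lemma holf w0int nz)
  obtain \<Phi> where \<Phi>: "\<And>x. x \<in> S \<Longrightarrow> (\<Phi> has_field_derivative \<phi> x) (at x within S)"
  proof (rule holomorphic_convex_primitive[OF \<open>convex S\<close>, of "{}" \<phi>])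
    show "continuous_on S \<phi>" using hol\<phi> by (rule holomorphic_on_imp_continuous_on)
    fix x assume "x \<in> interior S - {}"
    thus "\<phi> field_differentiable at x"
      using holomorphic_on_subset[OF hol\<phi> interior_subset]
      by (auto simp: holomorphic_on_open field_differentiable_def)
  qed auto
  have \<phi>_line: "((\<lambda>t. \<phi> (\<i> * of_real t)) has_integral (\<Phi> (\<i> * of_real R) - \<Phi> (- \<i> * of_real R)) / \<i>) {-R..R}"
    if "R > 0" for R :: real
  proof -
    have "((\<lambda>t. \<i> * \<phi> (\<i> * of_real t)) has_integral
             (\<Phi> (\<i> * of_real R) - \<Phi> (\<i> * of_real (- R)))) {-R..R}"
    proof (rule fundamental_theorem_of_calculus)
      fix t :: real
      have "((\<lambda>t. \<i> * of_real t) has_vector_derivative \<i>) (at t within {-R..R})"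
        by (auto intro!: derivative_eq_intros)
      moreover have "(\<Phi> has_field_derivative \<phi> (\<i> * of_real t))
          (at (\<i> * of_real t) within (\<lambda>t. \<i> * of_real t) ` {-R..R})"
        by (rule DERIV_subset[OF \<Phi>]) (auto simp: S_def)
      ultimately have "((\<Phi> \<circ> (\<lambda>t. \<i> * of_real t)) has_vector_derivative \<i> * \<phi> (\<i> * of_real t)) (at t within {-R..R})"
        by (rule field_vector_diff_chain_within)
      thus "((\<lambda>t. \<Phi> (\<i> * of_real t)) has_vector_derivative \<i> * \<phi> (\<i> * of_real t)) (at t within {-R..R})"
        by (simp add: o_def)
    qed (use that in auto)
    hence "((\<lambda>t. (1 / \<i>) * (\<i> * \<phi> (\<i> * of_real t))) has_integral
             (1 / \<i>) * (\<Phi> (\<i> * of_real R) - \<Phi> (\<i> * of_real (- R)))) {-R..R}"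
      by (rule has_integral_mult_right)
    thus ?thesis by (simp add: field_simps)
  qed
  \<comment> \<open>The same difference of \<open>\<Phi>\<close> is the integral of
    \<open>\<phi>\<close> along the right semicircle from -iR to iR.\<close>
  have arc: "norm (\<Phi> (\<i> * of_real R) - \<Phi> (- \<i> * of_real R)) \<le> B * R * pi"
    if "R > 0" "B \<ge> 0" and B: "\<And>w. Re w \<ge> 0 \<Longrightarrow> norm w = R \<Longrightarrow> norm (\<phi> w) \<le> B" for R B :: real
  proof -
    define \<gamma> where "\<gamma> = part_circlepath 0 R (-(pi/2)) (pi/2)"
    have img: "Re w \<ge> 0 \<and> norm w = R" if "w \<in> path_image \<gamma>" for w
    proof -
      from that obtain u where u: "w = of_real R * exp (\<i> * of_real u)" "-(pi/2) \<le> u" "u \<le> pi/2"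
        using \<open>R > 0\<close> by (auto simp: \<gamma>_def path_image_part_circlepath)
      moreover have "cos u \<ge> 0" using u by (intro cos_ge_zero) auto
      ultimately show ?thesis using \<open>R > 0\<close> by (auto simp: Re_exp norm_mult)
    qed
    have "(\<phi> has_contour_integral (\<Phi> (pathfinish \<gamma>) - \<Phi> (pathstart \<gamma>))) \<gamma>"
      by (rule contour_integral_primitive[of S]) (use \<Phi> img in \<open>auto simp: \<gamma>_def S_def\<close>)
    moreover have "pathfinish \<gamma> = \<i> * of_real R" "pathstart \<gamma> = - \<i> * of_real R"
      by (simp_all add: \<gamma>_def exp_eq_polar complex_eq_iff)
    ultimately have "(\<phi> has_contour_integral (\<Phi> (\<i> * of_real R) - \<Phi> (- \<i> * of_real R))) \<gamma>"
      by simp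
    from has_contour_integral_bound_part_circlepath_strong[OF this[unfolded \<gamma>_def], of "{}" B]
    show ?thesis using that img by (auto simp: \<gamma>_def)
  qed
  have lim0: "((\<lambda>R. integral {-R..R} (\<lambda>t. \<phi> (\<i> * of_real t))) \<longlongrightarrow> 0) at_top"
  proof (rule tendstoI)
    fix e :: real assume "e > 0"
    \<comment> \<open>The arc estimate below is 8 d / R; multiplied by the length pi R it becomes 8
      pi d = e/2.\<close>
    define d where "d = e / (16 * pi)"
    have "d > 0" using \<open>e > 0\<close> by (simp add: d_def)
    then obtain r where r: "\<And>w. Re w \<ge> 0 \<Longrightarrow> norm w \<ge> r \<Longrightarrow> norm (f w) \<le> d * norm w"
      using growth by blast
    \<comment> \<open>The bound 2 |w0| keeps the arc at distance at least R/2 from both w0 and -w0;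
      the bound |f w0| / d absorbs the constant f w0 into d R.\<close>
    have "eventually (\<lambda>R. R > max (max r 1) (max (2 * norm w0) (norm (f w0) / d))) at_top"
      by (rule eventually_gt_at_top)
    thus "eventually (\<lambda>R. dist (integral {-R..R} (\<lambda>t. \<phi> (\<i> * of_real t))) 0 < e) at_top"
    proof eventually_elim
      case (elim R)
      hence R: "R > r" "R > 1" "R > 2 * norm w0" "norm (f w0) < d * R"
        using \<open>d > 0\<close> by (auto simp: field_simps)
      have "norm (\<phi> w) \<le> 8 * d / R" if w: "Re w \<ge> 0" "norm w = R" for w
      proof -
        have "w \<noteq> w0" using R w by auto
        have "norm (f w - f w0) \<le> norm (f w) + norm (f w0)" by (rule norm_triangle_ineq4)
        also have "\<dots> \<le> 2 * d * R" using r[of w] w R by auto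
        finally have 1: "norm (f w - f w0) \<le> 2 * d * R" .
        have "R / 2 \<le> norm w - norm w0" using w R by auto
        also have "\<dots> \<le> norm (w - w0)" by (rule norm_triangle_ineq2)
        finally have 2: "R / 2 \<le> norm (w - w0)" .
        have "R / 2 \<le> norm w - norm w0" using w R by auto
        also have "\<dots> \<le> norm (w + w0)" by (rule norm_diff_ineq)
        finally have 3: "R / 2 \<le> norm (w + w0)" .
        have "norm (\<phi> w) = norm (f w - f w0) / (norm (w - w0) * norm (w + w0))"
          using \<open>w \<noteq> w0\<close> by (simp add: \<phi>_def norm_divide norm_mult)
        also have "\<dots> \<le> 2 * d * R / (R / 2 * (R / 2))"
          using R 1 2 3 \<open>d > 0\<close> by (intro frac_le mult_mono) auto
        also have "\<dots> = 8 * d / R" using R by (simp add: field_simps)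
        finally show ?thesis .
      qed
      hence "norm (\<Phi> (\<i> * of_real R) - \<Phi> (- \<i> * of_real R)) \<le> 8 * d / R * R * pi"
        by (intro arc) (use R \<open>d > 0\<close> in auto)
      also have "\<dots> = e / 2" using R by (simp add: d_def)
      also have "\<dots> < e" using \<open>e > 0\<close> by simp
      finally show ?case
        using \<phi>_line[of R] R by (auto simp: integral_unique norm_mult)
    qed
  qed
  have "((\<lambda>R. f w0 * integral {-R..R} (\<lambda>t. 1 / (of_real t ^ 2 + w0 ^ 2)) -
              integral {-R..R} (\<lambda>t. \<phi> (\<i> * of_real t))) \<longlongrightarrow> f w0 * (pi / w0) - 0) at_top"
    by (intro tendsto_intros lim0 integral_inverse_quadratic_limit w0)
  moreover have "eventually (\<lambda>R. f w0 * integral {-R..R} (\<lambda>t. 1 / (of_real t ^ 2 + w0 ^ 2)) -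
              integral {-R..R} (\<lambda>t. \<phi> (\<i> * of_real t)) =
            integral {-R..R} (\<lambda>t. f (\<i> * of_real t) / (of_real t ^ 2 + w0 ^ 2))) at_top"
    using eventually_gt_at_top[of 0]
  proof eventually_elim
    case (elim R)
    have nz': "of_real t ^ 2 + w0 ^ 2 \<noteq> 0" "\<i> * of_real t \<noteq> w0" for t
      using w0 by (auto simp: of_real_square_add_square_nonzero)
    have "f (\<i> * of_real t) / (of_real t ^ 2 + w0 ^ 2) =
            f w0 * (1 / (of_real t ^ 2 + w0 ^ 2)) - \<phi> (\<i> * of_real t)" for t
    proof -
      have "of_real t ^ 2 + w0 ^ 2 = -((\<i> * of_real t - w0) * (\<i> * of_real t + w0))"
        by (simp add: algebra_simps power2_eq_square)
      thus ?thesis using nz'(2)[of t] nz[of "\<i> * of_real t"]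
        by (simp add: \<phi>_def divide_simps S_def)
    qed
    moreover have "(\<lambda>t. 1 / (of_real t ^ 2 + w0 ^ 2)) integrable_on {-R..R}"
      by (intro integrable_continuous_interval continuous_intros) (use nz' in auto)
    moreover have "(\<lambda>t. \<phi> (\<i> * of_real t)) integrable_on {-R..R}"
      using \<phi>_line[OF elim] by (rule has_integral_integrable)
    ultimately show ?case
      by (simp add: integral_diff integrable_on_mult_right del: times_divide_eq_right)
  qed
  ultimately show ?thesis by (auto intro: Lim_transform_eventually simp: field_simps)
qed

text \<open>The kernel is even in t, so f(it) and f(-it) have the same integral against it. Hence f
  inside the half-plane is determined by the real density \<open>A\<close>, the sum of both boundary
  values.\<close>

lemma half_plane_even_boundary_limit:
  fixes f :: "complex \<Rightarrow> complex" and A :: "real \<Rightarrow> real"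
  assumes f: "f analytic_on {w. Re w \<ge> 0}" and w: "Re w > 0"
    and growth: "\<And>e. e > 0 \<Longrightarrow> \<exists>r. \<forall>w. Re w \<ge> 0 \<and> norm w \<ge> r \<longrightarrow> norm (f w) \<le> e * norm w"
    and A: "\<And>t. f (\<i> * of_real t) + f (- \<i> * of_real t) = of_real (A t)"
  shows "((\<lambda>R. integral {-R..R} (\<lambda>t. of_real (A t) / (of_real t ^ 2 + w ^ 2)))
           \<longlongrightarrow> 2 * pi * f w / w) at_top"
proof -
  define k where "k t = f (\<i> * of_real t) / (of_real t ^ 2 + w ^ 2)" for t :: real
  have nz: "of_real t ^ 2 + w ^ 2 \<noteq> 0" for t
    using w by (rule of_real_square_add_square_nonzero)
  have contf: "continuous_on {w. Re w \<ge> 0} f"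
    using f analytic_imp_holomorphic holomorphic_on_imp_continuous_on by blast
  have "integral {-R..R} (\<lambda>t. of_real (A t) / (of_real t ^ 2 + w ^ 2)) = 2 * integral {-R..R} k" for R
  proof -
    have cont: "continuous_on {-R..R} k"
      unfolding k_def by (intro continuous_intros continuous_on_compose2[OF contf]) (auto simp: nz)
    hence k: "k integrable_on {-R..R}" by (rule integrable_continuous_interval)
    have refl: "integral {-R..R} (\<lambda>t. k (-t)) = integral {-R..R} k"
      using Henstock_Kurzweil_Integration.integral_reflect_real[of R "-R" k] by simp
    have k': "(\<lambda>t. k (-t)) integrable_on {-R..R}"
      using Henstock_Kurzweil_Integration.integrable_reflect_real[of k R "-R"] k by simp
    have "of_real (A t) / (of_real t ^ 2 + w ^ 2) = k t + k (-t)" for t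
      using A[of t, symmetric] by (simp add: k_def add_divide_distrib)
    thus ?thesis using integral_add[OF k k'] refl by simp
  qed
  moreover have "((\<lambda>R. 2 * integral {-R..R} k) \<longlongrightarrow> 2 * (pi * f w / w)) at_top"
    unfolding k_def by (intro tendsto_mult_left half_plane_poisson_limit f w growth)
  ultimately show ?thesis by (simp add: mult.assoc)
qed

text \<open>The imaginary part of A/(t^2 + w^2) is -Im(w^2) A/|t^2 + w^2|^2, whose sign does not
  depend on t; for real w the kernel itself is positive. So the range |t| > T may be discarded, and
  on [-T, T] the denominator is at most T^2 + |w|^2 in modulus. The resulting bounds do not involve
  R and survive the limit; they are also continuous in w up to the axis away from w = 0.\<close>

lemma pick_limit_bounds:
  fixes A :: "real \<Rightarrow> real" and L w :: complex
  assumes A: "continuous_on UNIV A" "\<And>t. A t \<ge> 0" and w: "Re w > 0" and "T \<ge> 0"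
    and lim: "((\<lambda>R. integral {-R..R} (\<lambda>t. of_real (A t) / (of_real t ^ 2 + w ^ 2))) \<longlongrightarrow> L) at_top"
  shows pick_limit_Im: "- Im (w ^ 2) * Im L \<ge> Im (w ^ 2) ^ 2 * (integral {-T..T} A / (T ^ 2 + norm w ^ 2) ^ 2)"
    and pick_limit_Re: "Im w = 0 \<Longrightarrow> Re L \<ge> integral {-T..T} A / (T ^ 2 + norm w ^ 2)"
proof -
  define J where "J R = integral {-R..R} (\<lambda>t. of_real (A t) / (of_real t ^ 2 + w ^ 2))" for R
  have nz: "of_real t ^ 2 + w ^ 2 \<noteq> 0" for t
    using w by (rule of_real_square_add_square_nonzero)
  have Aint: "A integrable_on {a..b}" for a b
    by (intro integrable_continuous_interval continuous_on_subset[OF A(1)]) auto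
  have J: "(\<lambda>t. of_real (A t) / (of_real t ^ 2 + w ^ 2)) integrable_on {-R..R}" for R
    by (intro integrable_continuous_interval continuous_intros continuous_on_subset[OF A(1)]) (auto simp: nz)
  have N: "norm (of_real t ^ 2 + w ^ 2) \<le> T ^ 2 + norm w ^ 2" if "t \<in> {-T..T}" for t
  proof -
    have "norm (of_real t ^ 2 + w ^ 2) \<le> \<bar>t\<bar> ^ 2 + norm w ^ 2"
      by (rule order.trans[OF norm_triangle_ineq]) (simp add: norm_power)
    moreover have "\<bar>t\<bar> ^ 2 \<le> T ^ 2" using that by (intro power_mono) auto
    ultimately show ?thesis by linarith
  qed
  \<comment> \<open>Shared by both bounds: replace the kernel by a lower bound on [-T, T], then
    enlarge the interval. Both steps use that \<open>A\<close> and \<open>k\<close> are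
    nonnegative.\<close>
  have mono: "integral {-T..T} A * c \<le> integral {-R..R} (\<lambda>t. A t * k t)"
    if "continuous_on UNIV k" "\<And>t. k t \<ge> 0" "\<And>t. t \<in> {-T..T} \<Longrightarrow> c \<le> k t" "R \<ge> T" for k :: "real \<Rightarrow> real" and c R
  proof -
    have int: "(\<lambda>t. A t * k t) integrable_on {a..b}" for a b
      by (intro integrable_continuous_interval continuous_intros continuous_on_subset[OF A(1)]
            continuous_on_subset[OF that(1)]) auto
    have "integral {-T..T} A * c = integral {-T..T} (\<lambda>t. A t * c)" by simp
    also have "\<dots> \<le> integral {-T..T} (\<lambda>t. A t * k t)"
      by (intro integral_le int integrable_on_mult_left Aint) (use that in \<open>auto intro!: mult_left_mono A\<close>)
    also have "\<dots> \<le> integral {-R..R} (\<lambda>t. A t * k t)"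
      using that A by (intro integral_subset_le int) auto
    finally show ?thesis .
  qed
  show "- Im (w ^ 2) * Im L \<ge> Im (w ^ 2) ^ 2 * (integral {-T..T} A / (T ^ 2 + norm w ^ 2) ^ 2)"
  proof (rule tendsto_lowerbound)
    show "((\<lambda>R. - Im (w ^ 2) * Im (J R)) \<longlongrightarrow> - Im (w ^ 2) * Im L) at_top"
      using lim unfolding J_def by (intro tendsto_intros)
    show "eventually (\<lambda>R. Im (w ^ 2) ^ 2 * (integral {-T..T} A / (T ^ 2 + norm w ^ 2) ^ 2) \<le> - Im (w ^ 2) * Im (J R)) at_top"
      using eventually_ge_at_top[of T]
    proof eventually_elim
      case (elim R)
      define k where "k t = 1 / norm (of_real t ^ 2 + w ^ 2) ^ 2" for t :: real
      have "Im (J R) = integral {-R..R} (\<lambda>t. Im (of_real (A t) / (of_real t ^ 2 + w ^ 2)))"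
        unfolding J_def using J by (simp add: integral_linear[OF _ bounded_linear_Im, unfolded o_def])
      also have "(\<lambda>t. Im (of_real (A t) / (of_real t ^ 2 + w ^ 2))) = (\<lambda>t. - Im (w ^ 2) * (A t * k t))"
        by (rule ext) (simp add: Im_divide k_def cmod_power2 flip: of_real_power)
      finally have "- Im (w ^ 2) * Im (J R) = Im (w ^ 2) ^ 2 * integral {-R..R} (\<lambda>t. A t * k t)"
        by (simp add: power2_eq_square)
      moreover have "integral {-T..T} A * (1 / (T ^ 2 + norm w ^ 2) ^ 2) \<le> integral {-R..R} (\<lambda>t. A t * k t)"
      proof (rule mono)
        show "continuous_on UNIV k" unfolding k_def by (intro continuous_intros) (auto simp: nz)
        show "1 / (T ^ 2 + norm w ^ 2) ^ 2 \<le> k t" if "t \<in> {-T..T}" for t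
          unfolding k_def using N[OF that] nz[of t] by (intro frac_le power_mono) auto
      qed (use elim in \<open>auto simp: k_def\<close>)
      ultimately show ?case
        using mult_left_mono[of "integral {-T..T} A * (1 / (T ^ 2 + norm w ^ 2) ^ 2)" _ "Im (w ^ 2) ^ 2"] by simp
    qed
  qed simp
  show "Re L \<ge> integral {-T..T} A / (T ^ 2 + norm w ^ 2)" if w_real: "Im w = 0"
  proof (rule tendsto_lowerbound)
    show "((\<lambda>R. Re (J R)) \<longlongrightarrow> Re L) at_top"
      using lim unfolding J_def by (intro tendsto_intros)
    show "eventually (\<lambda>R. integral {-T..T} A / (T ^ 2 + norm w ^ 2) \<le> Re (J R)) at_top"
      using eventually_ge_at_top[of T]
    proof eventually_elim
      case (elim R)
      obtain x where x: "w = of_real x" "x > 0"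
        using w_real w by (intro that[of "Re w"]) (auto simp: complex_eq_iff)
      define k where "k t = 1 / (t ^ 2 + x ^ 2)" for t :: real
      have pos: "t ^ 2 + x ^ 2 > 0" for t using x by (simp add: add_nonneg_pos)
      have "Re (J R) = integral {-R..R} (\<lambda>t. Re (of_real (A t) / (of_real t ^ 2 + w ^ 2)))"
        unfolding J_def using J by (simp add: integral_linear[OF _ bounded_linear_Re, unfolded o_def])
      also have "(\<lambda>t. Re (of_real (A t) / (of_real t ^ 2 + w ^ 2))) = (\<lambda>t. A t * k t)"
        unfolding x k_def by (rule ext) (simp flip: of_real_power of_real_add of_real_divide)
      finally have "Re (J R) = integral {-R..R} (\<lambda>t. A t * k t)" .
      moreover have "integral {-T..T} A * (1 / (T ^ 2 + norm w ^ 2)) \<le> integral {-R..R} (\<lambda>t. A t * k t)"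
      proof (rule mono)
        show "continuous_on UNIV k" unfolding k_def using pos by (intro continuous_intros) (auto simp: less_le)
        show "1 / (T ^ 2 + norm w ^ 2) \<le> k t" if "t \<in> {-T..T}" for t
        proof -
          have "\<bar>t\<bar> ^ 2 \<le> T ^ 2" using that by (intro power_mono) auto
          thus ?thesis unfolding k_def x using pos[of t] by (intro frac_le) auto
        qed
      qed (use elim in \<open>auto simp: k_def\<close>)
      ultimately show ?case by simp
    qed
  qed simp
qed

section \<open>Functions unimodular on the imaginary axis with finitely many positive simple
  poles\<close>

text \<open>Riemann's removable singularity theorem: the hypothesis yields a holomorphic extension,
  and by continuity its value at p is the limit that \<open>remove_sings\<close> assigns.\<close>

lemma remove_sings_analytic_at_lim:
  assumes "isolated_singularity_at H p" and lim: "((\<lambda>z. (z - p) * H z) \<longlongrightarrow> 0) (at p)"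
  shows "remove_sings H analytic_on {p}"
proof -
  from assms(1) obtain r where r: "r > 0" "H analytic_on ball p r - {p}"
    by (auto simp: isolated_singularity_at_def)
  hence "H holomorphic_on ball p r - {p}" by (intro analytic_imp_holomorphic)
  then obtain g where g: "g holomorphic_on ball p r" "\<And>z. z \<in> ball p r - {p} \<Longrightarrow> g z = H z"
    using holomorphic_on_extend_lim[of H "ball p r" p] lim r by (auto simp: interior_open)
  have "isCont g p"
    using holomorphic_on_imp_continuous_on[OF g(1)] r by (simp add: continuous_on_eq_continuous_at)
  hence "g \<midarrow>p\<rightarrow> g p" by (simp add: isCont_def)
  moreover have "eventually (\<lambda>z. g z = H z) (at p)"
    by (rule eventually_mono[OF eventually_at_in_open[of "ball p r" p]]) (use g r in auto)
  ultimately have "H \<midarrow>p\<rightarrow> g p" by (rule Lim_transform_eventually)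
  with assms(1) show ?thesis by (rule remove_sings_analytic_at)
qed

lemma Re_Im_divide_of_real:
  "Re (of_real r / z) = r * Re z / norm z ^ 2" "Im (of_real r / z) = - r * Im z / norm z ^ 2"
  by (simp_all add: Re_divide Im_divide cmod_power2)

text \<open>Models plus or minus \<open>c_quot h\<close> in the coordinate w = s - 1/2. Poles are
  recorded by limits, so subtracting explicit principal parts is a matter of limit arithmetic. The
  functional equation enters through its trace on the axis, \<open>sym\<close> and
  \<open>uni\<close>.\<close>

locale unimodular_half_plane =
  fixes F :: "complex \<Rightarrow> complex" and P :: "real set" and \<rho> :: "real \<Rightarrow> real"
  assumes P: "finite P" "\<And>p. p \<in> P \<Longrightarrow> p > 0" and \<rho>: "\<And>p. p \<in> P \<Longrightarrow> \<rho> p \<ge> 0"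
    and ana: "\<And>w. Re w \<ge> 0 \<Longrightarrow> w \<notin> of_real ` P \<Longrightarrow> F analytic_on {w}"
    and res: "\<And>p. p \<in> P \<Longrightarrow> ((\<lambda>w. (w - of_real p) * F w) \<longlongrightarrow> of_real (\<rho> p)) (at (of_real p))"
    and growth: "\<And>e. e > 0 \<Longrightarrow> \<exists>r. \<forall>w. Re w \<ge> 0 \<and> norm w \<ge> r \<longrightarrow> norm (F w) \<le> e * norm w"
    and sym: "\<And>t. F (- \<i> * of_real t) = cnj (F (\<i> * of_real t))"
    and uni: "\<And>t. norm (F (\<i> * of_real t)) = 1"
    and nontrivial: "\<exists>t. 1 + F (\<i> * of_real t) \<noteq> 0"
begin

lemma lower_bounds:
  obtains T m where "m > 0"
    "\<And>w. Re w > 0 \<Longrightarrow> w \<notin> of_real ` P \<Longrightarrow>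
       \<bar>Im (w ^ 2)\<bar> * (m / (T ^ 2 + norm w ^ 2) ^ 2) \<le> norm (2 * pi * (1 + F w) / w)"
    "\<And>x. x > 0 \<Longrightarrow> (\<And>p. p \<in> P \<Longrightarrow> p < x) \<Longrightarrow> 1 + F (of_real x) \<noteq> 0"
proof -
  obtain t0 where nt: "1 + F (\<i> * of_real t0) \<noteq> 0" using nontrivial by blast
  \<comment> \<open>\<open>K p\<close> has residue 1 at \<open>p\<close> and is odd, so subtracting it does not change the even part on the axis.\<close>
  define K where "K p w = 2 * w / (w ^ 2 - of_real p ^ 2)" for p :: real and w :: complex
  define H where "H w = 1 + F w - (\<Sum>p\<in>P. of_real (\<rho> p) * K p w)" for w
  define f where "f = remove_sings H"
  define A where "A t = norm (1 + F (\<i> * of_real t)) ^ 2" for t :: real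
  \<comment> \<open>The interval [-T, T] contains t0, and the added 1 keeps it nondegenerate when t0
    = 0; so the continuous function \<open>A\<close> has positive integral \<open>m\<close>.\<close>
  define T where "T = \<bar>t0\<bar> + 1"
  define m where "m = integral {-T..T} A"
  have diff_nz: "w ^ 2 - of_real p ^ 2 \<noteq> 0" if "Re w \<ge> 0" "p > 0" "w \<noteq> of_real p" for w :: complex and p
  proof -
    have "w + of_real p \<noteq> 0" using that by (auto simp: complex_eq_iff)
    moreover have "w ^ 2 - of_real p ^ 2 = (w - of_real p) * (w + of_real p)"
      by (simp add: algebra_simps power2_eq_square)
    ultimately show ?thesis using that by simp
  qed
  have H_ana: "H analytic_on {w}" if "Re w \<ge> 0" "w \<notin> of_real ` P" for w
    unfolding H_def K_def using that P diff_nz ana[OF that]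
    by (intro analytic_intros) auto
  have H_iso: "isolated_singularity_at H (of_real p)" and
       H_lim: "((\<lambda>w. (w - of_real p) * H w) \<longlongrightarrow> 0) (at (of_real p))" if "p \<in> P" for p
  proof -
    define U where "U = {w. Re w > 0} - (of_real ` (P - {p}) :: complex set)"
    have "open U" unfolding U_def using P
      by (intro open_Diff open_halfspace_Re_gt finite_imp_closed) auto
    moreover have "of_real p \<in> U" using P that by (auto simp: U_def)
    ultimately obtain r where r: "r > 0" "ball (of_real p) r \<subseteq> U"
      using openE by blast
    have "H analytic_on ball (of_real p) r - {of_real p}"
    proof (subst analytic_on_analytic_at, rule ballI)
      fix z assume "z \<in> ball (complex_of_real p) r - {complex_of_real p}"
      hence "z \<in> U" "z \<noteq> of_real p" using r by auto
      thus "H analytic_on {z}" by (intro H_ana) (auto simp: U_def)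
    qed
    with r show "isolated_singularity_at H (of_real p)"
      by (auto simp: isolated_singularity_at_def)
    have Klim: "((\<lambda>w. (w - of_real p) * K q w) \<longlongrightarrow> (if q = p then 1 else 0)) (at (of_real p))"
      if q: "q \<in> P" for q
    proof (cases "q = p")
      case True
      have "p > 0" using P \<open>p \<in> P\<close> by blast
      hence "((\<lambda>w. 2 * w / (w + of_real p)) \<longlongrightarrow> 2 * of_real p / (of_real p + of_real p)) (at (of_real p :: complex))"
        by (intro tendsto_intros) (simp flip: of_real_add)
      moreover have "2 * of_real p / (of_real p + of_real p) = (1 :: complex)"
        using \<open>p > 0\<close> by (simp add: field_simps)
      moreover have "eventually (\<lambda>w. 2 * w / (w + of_real p) = (w - of_real p) * K q w) (at (of_real p))"
        using eventually_at_in_open[OF \<open>open U\<close> \<open>of_real p \<in> U\<close>]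
      proof eventually_elim
        case (elim w)
        hence "w - of_real p \<noteq> 0" "w + of_real p \<noteq> 0"
          using \<open>p > 0\<close> by (auto simp: U_def complex_eq_iff)
        moreover have "w ^ 2 - of_real p ^ 2 = (w - of_real p) * (w + of_real p)"
          by (simp add: algebra_simps power2_eq_square)
        ultimately show ?case by (simp add: K_def True)
      qed
      ultimately show ?thesis using True by (auto intro: Lim_transform_eventually)
    next
      case False
      have "((\<lambda>w. (w - of_real p) * K q w) \<longlongrightarrow> (of_real p - of_real p) * K q (of_real p)) (at (of_real p))"
        unfolding K_def using False P(2)[OF q] P(2)[OF \<open>p \<in> P\<close>] by (intro tendsto_intros diff_nz) auto
      thus ?thesis using False by simp
    qed
    have "((\<lambda>w. (w - of_real p) + (w - of_real p) * F w - (\<Sum>q\<in>P. of_real (\<rho> q) * ((w - of_real p) * K q w))) \<longlongrightarrow>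
       (of_real p - of_real p) + of_real (\<rho> p) - (\<Sum>q\<in>P. of_real (\<rho> q) * (if q = p then 1 else 0))) (at (of_real p))"
      by (intro tendsto_intros Klim res that)
    moreover have "(\<Sum>q\<in>P. of_real (\<rho> q) * (if q = p then 1 else 0)) = complex_of_real (\<rho> p)"
      using P(1) that by (subst sum.remove[of _ p]) auto
    moreover have "(w - of_real p) + (w - of_real p) * F w - (\<Sum>q\<in>P. of_real (\<rho> q) * ((w - of_real p) * K q w))
       = (w - of_real p) * H w" for w
      by (simp add: H_def ring_distribs sum_distrib_left mult_ac)
    ultimately show "((\<lambda>w. (w - of_real p) * H w) \<longlongrightarrow> 0) (at (of_real p))" by simp
  qed
  have f_eq: "f w = H w" if "Re w \<ge> 0" "w \<notin> of_real ` P" for w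
    unfolding f_def using H_ana[OF that] by simp
  have f_ana: "f analytic_on {w. Re w \<ge> 0}"
  proof (subst analytic_on_analytic_at, rule ballI)
    fix w :: complex assume w: "w \<in> {w. Re w \<ge> 0}"
    show "f analytic_on {w}"
    proof (cases "w \<in> of_real ` P")
      case True
      thus ?thesis unfolding f_def using H_iso H_lim by (auto intro: remove_sings_analytic_at_lim)
    next
      case False
      thus ?thesis unfolding f_def using w H_ana by (intro remove_sings_analytic_on) auto
    qed
  qed
  have f_growth: "\<exists>r. \<forall>w. Re w \<ge> 0 \<and> norm w \<ge> r \<longrightarrow> norm (f w) \<le> e * norm w" if "e > 0" for e
  proof -
    obtain r where r: "\<And>w. Re w \<ge> 0 \<Longrightarrow> norm w \<ge> r \<Longrightarrow> norm (F w) \<le> e / 2 * norm w"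
      using growth[of "e / 2"] \<open>e > 0\<close> by auto
    \<comment> \<open>\<open>M\<close> bounds 1 plus the pole terms, since |K p w| is at most 2 once
      |w| is at least p + 1. The radius \<open>r'\<close> then makes \<open>M\<close> at most (e/2)
      |w|, leaving e/2 for F.\<close>
    define M where "M = 1 + (\<Sum>p\<in>P. \<rho> p * 2)"
    define r' where "r' = Max (insert r (insert (2 * M / e) ((\<lambda>p. p + 1) ` P)))"
    have "norm (f w) \<le> e * norm w" if w: "Re w \<ge> 0" "norm w \<ge> r'" for w
    proof -
      have w1: "norm w \<ge> r" "norm w \<ge> 2 * M / e" and w2: "\<And>p. p \<in> P \<Longrightarrow> norm w \<ge> p + 1"
        using w P(1) by (auto simp: r'_def)
      have wP: "w \<notin> of_real ` P"
      proof
        assume "w \<in> of_real ` P"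
        then obtain p where "p \<in> P" "w = of_real p" by auto
        thus False using w2[of p] P(2)[of p] by auto
      qed
      have K2: "norm (K p w) \<le> 2" if "p \<in> P" for p
      proof -
        have p: "p > 0" using P that by auto
        have "norm w - norm (complex_of_real p) \<le> norm (w - of_real p)" by (rule norm_triangle_ineq2)
        hence 1: "1 \<le> norm (w - of_real p)" using w2[OF that] p by simp
        \<comment> \<open>Moving right by p > 0 does not decrease the modulus of a point with
          nonnegative real part.\<close>
        have 2: "norm w \<le> norm (w + of_real p)"
          unfolding cmod_def using w p by (simp add: power_mono)
        have "norm w * 1 \<le> norm (w + of_real p) * norm (w - of_real p)"
          using 1 2 by (intro mult_mono) auto
        also have "\<dots> = norm (w ^ 2 - of_real p ^ 2)"
          by (simp add: algebra_simps power2_eq_square flip: norm_mult)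
        finally have "norm w \<le> norm (w ^ 2 - of_real p ^ 2)" by simp
        moreover have "norm w > 0" using w2[OF that] p by auto
        ultimately show ?thesis by (simp add: K_def norm_divide norm_mult divide_le_eq)
      qed
      have "norm (f w) = norm (1 + F w - (\<Sum>p\<in>P. of_real (\<rho> p) * K p w))"
        using f_eq[OF w(1) wP] by (simp add: H_def)
      also have "\<dots> \<le> 1 + norm (F w) + norm (\<Sum>p\<in>P. of_real (\<rho> p) * K p w)"
        by (rule order.trans[OF norm_triangle_ineq4])
           (simp add: order.trans[OF norm_triangle_ineq])
      also have "norm (\<Sum>p\<in>P. of_real (\<rho> p) * K p w) \<le> (\<Sum>p\<in>P. \<rho> p * 2)"
        by (rule sum_norm_le) (use \<rho> K2 in \<open>auto simp: norm_mult intro!: mult_left_mono\<close>)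
      also have "1 + norm (F w) + (\<Sum>p\<in>P. \<rho> p * 2) = norm (F w) + M" by (simp add: M_def)
      also have "\<dots> \<le> e / 2 * norm w + e / 2 * norm w"
        using r[OF w(1) w1(1)] w1(2) \<open>e > 0\<close> by (intro add_mono) (auto simp: field_simps)
      finally show ?thesis by simp
    qed
    thus ?thesis by blast
  qed
  have line: "\<i> * of_real t \<notin> of_real ` P" "- \<i> * of_real t \<notin> of_real ` P" for t
    using P(2) by (force simp: complex_eq_iff)+
  have fA: "f (\<i> * of_real t) + f (- \<i> * of_real t) = of_real (A t)" for t
  proof -
    have "K p (- \<i> * of_real t) = - K p (\<i> * of_real t)" for p by (simp add: K_def)
    hence "f (\<i> * of_real t) + f (- \<i> * of_real t) = 2 + (F (\<i> * of_real t) + cnj (F (\<i> * of_real t)))"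
      using line[of t] f_eq[of "\<i> * of_real t"] f_eq[of "- \<i> * of_real t"] sym[of t]
      by (simp add: H_def sum_negf)
    also have "\<dots> = of_real (2 + 2 * Re (F (\<i> * of_real t)))"
      by (simp add: complex_add_cnj)
    also have "2 + 2 * Re (F (\<i> * of_real t)) = A t"
    proof -
      have "Re (F (\<i> * of_real t)) ^ 2 + Im (F (\<i> * of_real t)) ^ 2 = 1"
        using uni[of t] by (metis cmod_power2 one_power2)
      thus ?thesis unfolding A_def cmod_power2 by (simp add: power2_eq_square algebra_simps)
    qed
    finally show ?thesis .
  qed
  have A_cont: "continuous_on UNIV A"
  proof -
    have "F analytic_on range (\<lambda>t::real. \<i> * of_real t)"
      by (subst analytic_on_analytic_at) (use line in \<open>auto intro!: ana\<close>)
    hence "continuous_on (range (\<lambda>t::real. \<i> * of_real t)) F"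
      using analytic_imp_holomorphic holomorphic_on_imp_continuous_on by blast
    hence "continuous_on UNIV (\<lambda>t::real. F (\<i> * of_real t))"
      by (rule continuous_on_compose2) (auto intro!: continuous_intros)
    thus ?thesis unfolding A_def by (intro continuous_intros)
  qed
  have A_nonneg: "A t \<ge> 0" for t by (simp add: A_def)
  have "m \<noteq> 0"
  proof
    assume "m = 0"
    hence "\<forall>t\<in>{-T..T}. A t = 0"
      using integral_eq_0_iff[of "-T" T A] continuous_on_subset[OF A_cont] A_nonneg
      by (auto simp: m_def T_def)
    moreover have "t0 \<in> {-T..T}" by (auto simp: T_def)
    ultimately have "A t0 = 0" by blast
    thus False using nt by (simp add: A_def)
  qed
  moreover have "m \<ge> 0" unfolding m_def
    by (intro integral_nonneg integrable_continuous_interval continuous_on_subset[OF A_cont]) (auto simp: A_nonneg)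
  ultimately have "m > 0" by simp
  have lim: "((\<lambda>R. integral {-R..R} (\<lambda>t. of_real (A t) / (of_real t ^ 2 + w ^ 2)))
           \<longlongrightarrow> 2 * pi * f w / w) at_top" if "Re w > 0" for w
    by (rule half_plane_even_boundary_limit[OF f_ana that f_growth fA])
  \<comment> \<open>The factor w of \<open>K p w\<close> cancels the division by w. In the variable
    w^2 the pole terms are point masses at p^2, of the same type as the integral, whose measure
    lives at the points -t^2.\<close>
  have split: "2 * pi * (1 + F w) / w = 2 * pi * f w / w + (\<Sum>p\<in>P. of_real (4 * pi * \<rho> p) / (w ^ 2 - of_real p ^ 2))"
    if w: "Re w > 0" "w \<notin> of_real ` P" for w
  proof -
    have "w \<noteq> 0" using w by auto
    have "1 + F w = f w + (\<Sum>p\<in>P. of_real (\<rho> p) * K p w)"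
      using f_eq[of w] w by (simp add: H_def)
    hence "2 * pi * (1 + F w) / w = 2 * pi * f w / w + (\<Sum>p\<in>P. 2 * pi * (of_real (\<rho> p) * K p w) / w)"
      by (simp add: ring_distribs add_divide_distrib sum_distrib_left sum_divide_distrib)
    also have "(\<Sum>p\<in>P. 2 * pi * (of_real (\<rho> p) * K p w) / w) =
          (\<Sum>p\<in>P. of_real (4 * pi * \<rho> p) / (w ^ 2 - of_real p ^ 2))"
      using \<open>w \<noteq> 0\<close> by (intro sum.cong) (auto simp: K_def)
    finally show ?thesis .
  qed
  have "T \<ge> 0" by (simp add: T_def)
  show ?thesis
  proof (rule that[OF \<open>m > 0\<close>])
    fix w :: complex assume w: "Re w > 0" "w \<notin> of_real ` P"
    define I where "I = Im (w ^ 2)"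
    define \<kappa> where "\<kappa> = m / (T ^ 2 + norm w ^ 2) ^ 2"
    define S where "S = 2 * pi * (1 + F w) / w"
    have "I ^ 2 * \<kappa> \<le> - I * Im (2 * pi * f w / w)"
      using pick_limit_Im[OF A_cont A_nonneg w(1) \<open>T \<ge> 0\<close> lim[OF w(1)]] by (simp add: I_def \<kappa>_def m_def)
    \<comment> \<open>Since w^2 - p^2 also has imaginary part \<open>I\<close>, each pole term
      contributes with the same sign as the integral. Multiplying by -I treats both signs of
      \<open>I\<close> together.\<close>
    also have "\<dots> \<le> - I * Im (2 * pi * f w / w) +
                 (\<Sum>p\<in>P. I ^ 2 * (4 * pi * \<rho> p / norm (w ^ 2 - of_real p ^ 2) ^ 2))"
      using \<rho> by (simp add: sum_nonneg)
    also have "(\<Sum>p\<in>P. I ^ 2 * (4 * pi * \<rho> p / norm (w ^ 2 - of_real p ^ 2) ^ 2)) =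
               (\<Sum>p\<in>P. - I * Im (of_real (4 * pi * \<rho> p) / (w ^ 2 - of_real p ^ 2)))"
      unfolding Re_Im_divide_of_real by (intro sum.cong) (auto simp: I_def power2_eq_square)
    also have "- I * Im (2 * pi * f w / w) + \<dots> = - I * Im S"
      unfolding S_def split[OF w] by (simp add: sum_distrib_left ring_distribs sum_negf)
    also have "\<dots> \<le> \<bar>I\<bar> * norm S"
      using abs_Im_le_cmod[of S] abs_ge_self[of "- I * Im S"]
      by (simp add: abs_mult) (meson abs_ge_zero mult_left_mono order_trans)
    finally have "\<bar>I\<bar> * (\<bar>I\<bar> * \<kappa>) \<le> \<bar>I\<bar> * norm S" by (simp add: power2_eq_square)
    hence "\<bar>I\<bar> * \<kappa> \<le> norm S"
      by (cases "I = 0") auto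
    thus "\<bar>Im (w ^ 2)\<bar> * (m / (T ^ 2 + norm w ^ 2) ^ 2) \<le> norm (2 * pi * (1 + F w) / w)"
      by (simp add: I_def \<kappa>_def S_def)
  next
    fix x :: real assume x: "x > 0" and px: "\<And>p. p \<in> P \<Longrightarrow> p < x"
    have xP: "complex_of_real x \<notin> of_real ` P" using px by fastforce
    have "0 < m / (T ^ 2 + norm (complex_of_real x) ^ 2)"
      using \<open>m > 0\<close> x by (intro divide_pos_pos add_nonneg_pos) auto
    also have "\<dots> \<le> Re (2 * pi * f (of_real x) / of_real x)"
      using pick_limit_Re[OF A_cont A_nonneg _ \<open>T \<ge> 0\<close> lim[of "of_real x"]] x by (simp add: m_def)
    \<comment> \<open>Because x exceeds every p, each \<rho> p / (x^2 - p^2) is nonnegative; a pole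
      to the right of x could contribute a negative term.\<close>
    also have "\<dots> \<le> \<dots> + (\<Sum>p\<in>P. Re (of_real (4 * pi * \<rho> p) / (of_real x ^ 2 - of_real p ^ 2)))"
    proof -
      have "0 \<le> Re (of_real (4 * pi * \<rho> p) / (of_real x ^ 2 - of_real p ^ 2))" if "p \<in> P" for p
      proof -
        have "p ^ 2 \<le> x ^ 2" using px[OF that] P(2)[OF that] by (intro power_mono) auto
        thus ?thesis using \<rho>[OF that] by (simp flip: of_real_power of_real_diff of_real_divide)
      qed
      thus ?thesis by (simp add: sum_nonneg del: of_real_mult)
    qed
    also have "\<dots> = Re (2 * pi * (1 + F (of_real x)) / of_real x)"
      using split[of "of_real x"] x xP by simp
    finally have "2 * pi * (1 + F (of_real x)) / of_real x \<noteq> 0"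
      by (metis less_irrefl zero_complex.simps(1))
    thus "1 + F (of_real x) \<noteq> 0" by simp
  qed
qed


text \<open>At a zero with Re w0 > 0 the first lower bound forces Im(w0^2) = 0, so w0 is real, and
  the second bound places it no further right than some pole. At a multiple zero 1 + F would be o(|w
  - w0|), while the lower bound decays only linearly along a suitable ray from w0.\<close>

lemma zeros:
  assumes w0: "Re w0 \<ge> 0" "w0 \<notin> of_real ` P" and zero: "1 + F w0 = 0"
  shows zero_location: "Re w0 = 0 \<or> Im w0 = 0 \<and> (\<exists>p\<in>P. Re w0 \<le> p)"
    and zero_simple: "w0 \<noteq> 0 \<Longrightarrow> deriv F w0 \<noteq> 0"
proof -
  obtain T m where m: "m > 0" and
    Im_bound: "\<And>w. Re w > 0 \<Longrightarrow> w \<notin> of_real ` P \<Longrightarrow>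
       \<bar>Im (w ^ 2)\<bar> * (m / (T ^ 2 + norm w ^ 2) ^ 2) \<le> norm (2 * pi * (1 + F w) / w)" and
    Re_bound: "\<And>x. x > 0 \<Longrightarrow> (\<And>p. p \<in> P \<Longrightarrow> p < x) \<Longrightarrow> 1 + F (of_real x) \<noteq> 0"
    by (rule lower_bounds) blast
  have pos: "m / (T ^ 2 + norm w ^ 2) ^ 2 > 0" if "w \<noteq> 0" for w :: complex
    using that m by (intro divide_pos_pos zero_less_power add_nonneg_pos) auto
  show loc: "Re w0 = 0 \<or> Im w0 = 0 \<and> (\<exists>p\<in>P. Re w0 \<le> p)"
  proof (cases "Re w0 = 0")
    case False
    hence w0': "Re w0 > 0" using w0 by simp
    hence "\<bar>Im (w0 ^ 2)\<bar> * (m / (T ^ 2 + norm w0 ^ 2) ^ 2) \<le> 0"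
      using Im_bound[of w0] w0 zero by simp
    moreover have "w0 \<noteq> 0" using False by auto
    ultimately have "Im (w0 ^ 2) = 0"
      using pos[of w0] mult_pos_pos[of "\<bar>Im (w0 ^ 2)\<bar>" "m / (T ^ 2 + norm w0 ^ 2) ^ 2"] by force
    hence "Im w0 = 0" using False by (simp add: power2_eq_square)
    moreover from this have "of_real (Re w0) = w0" by (simp add: complex_eq_iff)
    ultimately show ?thesis using Re_bound[of "Re w0"] w0' zero by force
  qed simp
  show "deriv F w0 \<noteq> 0" if "w0 \<noteq> 0"
  proof
    assume der0: "deriv F w0 = 0"
    \<comment> \<open>a direction along which \<open>Im (w\<^sup>2)\<close> leaves 0 at linear speed while \<open>Re w\<close> stays positive\<close>
    define d where "d = (if Re w0 = 0 then 1 else \<i>)"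
    define \<gamma> where "\<gamma> \<eta> = w0 + of_real \<eta> * d" for \<eta> :: real
    \<comment> \<open>By \<open>loc\<close>, w0 is real or purely imaginary, so Im(w0^2) = Im(d^2) =
      0 and Im(w0 d) is w0 up to a unit factor; only the cross term 2 \<eta> Im(w0 d) remains. The
      ray also leaves the real axis, hence avoids the poles.\<close>
    have \<gamma>: "Re (\<gamma> \<eta>) > 0" "\<gamma> \<eta> \<notin> of_real ` P" "\<bar>Im (\<gamma> \<eta> ^ 2)\<bar> = 2 * \<eta> * norm w0"
            "norm (\<gamma> \<eta> - w0) = \<eta>" if "\<eta> > 0" for \<eta>
      using that loc w0 \<open>w0 \<noteq> 0\<close>
      by (auto simp: \<gamma>_def d_def complex_eq_iff power2_eq_square cmod_def abs_mult norm_mult)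
    have flim: "filterlim \<gamma> (at w0) (at_right 0)"
      unfolding filterlim_at
    proof
      have "(\<gamma> \<longlongrightarrow> w0 + of_real 0 * d) (at_right 0)"
        unfolding \<gamma>_def by (intro tendsto_intros)
      thus "(\<gamma> \<longlongrightarrow> w0) (at_right 0)" by simp
      show "\<forall>\<^sub>F x in at_right 0. \<gamma> x \<in> UNIV \<and> \<gamma> x \<noteq> w0"
        using eventually_at_right_less[of 0] by eventually_elim (auto simp: \<gamma>_def d_def)
    qed
    have "(F has_field_derivative 0) (at w0)"
      using ana[OF w0] der0 by (metis analytic_on_imp_differentiable_at insertI1 DERIV_deriv_iff_field_differentiable)
    hence "((\<lambda>w. (F w - F w0) / (w - w0)) \<longlongrightarrow> 0) (at w0)"
      by (simp add: has_field_derivative_iff)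
    moreover have "F w0 = - 1" using zero by (simp add: add_eq_0_iff)
    ultimately have "((\<lambda>w. (1 + F w) / (w - w0)) \<longlongrightarrow> 0) (at w0)" by (simp add: add.commute)
    hence lim: "((\<lambda>\<eta>. (1 + F (\<gamma> \<eta>)) / (\<gamma> \<eta> - w0)) \<longlongrightarrow> 0) (at_right 0)"
      using flim by (rule filterlim_compose)
    have \<gamma>_lim: "(\<gamma> \<longlongrightarrow> w0) (at_right 0)"
      using flim by (simp add: filterlim_at)
    \<comment> \<open>Divide the first lower bound at \<open>\<gamma> \<eta>\<close> by \<eta> and
      let \<eta> tend to 0: the left side stays positive, while the right side tends to a multiple
      of the vanishing derivative.\<close>
    have "2 * norm w0 * (m / (T ^ 2 + norm w0 ^ 2) ^ 2) \<le> norm (complex_of_real (2 * pi) * 0 / w0)"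
    proof (rule tendsto_le)
      show "((\<lambda>\<eta>. norm (2 * pi * ((1 + F (\<gamma> \<eta>)) / (\<gamma> \<eta> - w0)) / \<gamma> \<eta>)) \<longlongrightarrow> norm (complex_of_real (2 * pi) * 0 / w0)) (at_right 0)"
        using \<open>w0 \<noteq> 0\<close> by (intro tendsto_intros lim \<gamma>_lim)
      show "((\<lambda>\<eta>. 2 * norm w0 * (m / (T ^ 2 + norm (\<gamma> \<eta>) ^ 2) ^ 2)) \<longlongrightarrow>
               2 * norm w0 * (m / (T ^ 2 + norm w0 ^ 2) ^ 2)) (at_right 0)"
        using pos[OF \<open>w0 \<noteq> 0\<close>] by (intro tendsto_intros \<gamma>_lim) auto
      show "\<forall>\<^sub>F \<eta> in at_right 0. 2 * norm w0 * (m / (T ^ 2 + norm (\<gamma> \<eta>) ^ 2) ^ 2) \<le>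
              norm (2 * pi * ((1 + F (\<gamma> \<eta>)) / (\<gamma> \<eta> - w0)) / \<gamma> \<eta>)"
        using eventually_at_right_less[of 0]
      proof eventually_elim
        case (elim \<eta>)
        have "2 * norm w0 * (m / (T ^ 2 + norm (\<gamma> \<eta>) ^ 2) ^ 2)
               = \<bar>Im (\<gamma> \<eta> ^ 2)\<bar> * (m / (T ^ 2 + norm (\<gamma> \<eta>) ^ 2) ^ 2) / \<eta>"
          using elim by (simp add: \<gamma>(3)[OF elim])
        also have "\<dots> \<le> norm (2 * pi * (1 + F (\<gamma> \<eta>)) / \<gamma> \<eta>) / \<eta>"
          using elim by (intro divide_right_mono Im_bound \<gamma>) auto
        also have "\<dots> = norm (2 * pi * ((1 + F (\<gamma> \<eta>)) / (\<gamma> \<eta> - w0)) / \<gamma> \<eta>)"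
          by (simp add: norm_divide norm_mult \<gamma>(4)[OF elim])
        finally show ?case .
      qed
    qed simp
    moreover have "2 * norm w0 * (m / (T ^ 2 + norm w0 ^ 2) ^ 2) > 0"
      using \<open>w0 \<noteq> 0\<close> pos[OF \<open>w0 \<noteq> 0\<close>] by (intro mult_pos_pos) auto
    ultimately show False by simp
  qed
qed

end

section \<open>Conjugation and reflection of meromorphic functions\<close>

lemma filterlim_cnj_at: "filterlim cnj (at (cnj z)) (at z)"
  unfolding filterlim_at by (auto intro!: tendsto_intros simp: eventually_at_filter)

lemma filterlim_one_minus_at: "filterlim (\<lambda>w. 1 - w) (at (1 - z)) (at (z :: complex))"
  unfolding filterlim_at by (auto intro!: tendsto_intros simp: eventually_at_filter)

lemma isCont_eventually_eq_at:
  fixes f g :: "complex \<Rightarrow> complex"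
  assumes "isCont f z" "isCont g z" "eventually (\<lambda>w. f w = g w) (at z)"
  shows "f z = g z"
proof -
  have "(g \<longlongrightarrow> f z) (at z)"
    using assms(1,3) by (auto simp: isCont_def intro: Lim_transform_eventually)
  thus ?thesis using assms(2) by (auto simp: isCont_def intro: tendsto_unique[OF at_neq_bot])
qed

lemma meromorphic_on_cnj_cnj:
  assumes "f meromorphic_on UNIV"
  shows "(\<lambda>z. cnj (f (cnj z))) meromorphic_on UNIV"
  unfolding meromorphic_on_altdef
proof (intro ballI conjI)
  fix z :: complex
  have f: "isolated_singularity_at f (cnj z)" "not_essential f (cnj z)"
    using assms by (auto simp: meromorphic_on_altdef)
  from f(1) obtain r where r: "r > 0" "f analytic_on ball (cnj z) r - {cnj z}"
    by (auto simp: isolated_singularity_at_def)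
  have "cnj ` (ball z r - {z}) \<subseteq> ball (cnj z) r - {cnj z}"
    by (auto simp: dist_norm simp flip: complex_cnj_diff)
  hence "f holomorphic_on cnj ` (ball z r - {z})"
    using r analytic_imp_holomorphic holomorphic_on_subset by blast
  hence "cnj \<circ> f \<circ> cnj holomorphic_on (ball z r - {z})"
    by (intro holomorphic_on_compose_cnj_cnj) auto
  hence "(\<lambda>z. cnj (f (cnj z))) analytic_on (ball z r - {z})"
    by (subst analytic_on_open) (auto simp: o_def)
  thus "isolated_singularity_at (\<lambda>z. cnj (f (cnj z))) z"
    using r by (auto simp: isolated_singularity_at_def)
  from f(2) consider l where "(f \<longlongrightarrow> l) (at (cnj z))" | "is_pole f (cnj z)"
    by (auto simp: not_essential_def)
  thus "not_essential (\<lambda>z. cnj (f (cnj z))) z"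
  proof cases
    case (1 l)
    have "((\<lambda>z. cnj (f (cnj z))) \<longlongrightarrow> cnj l) (at z)"
      by (intro tendsto_cnj filterlim_compose[OF 1 filterlim_cnj_at])
    thus ?thesis by (auto simp: not_essential_def)
  next
    case 2
    hence "filterlim f at_infinity (at (cnj z))" by (simp add: is_pole_def)
    from filterlim_compose[OF this filterlim_cnj_at]
    have "filterlim (\<lambda>z. f (cnj z)) at_infinity (at z)" .
    hence "filterlim (\<lambda>z. cnj (f (cnj z))) at_infinity (at z)"
      by (simp add: filterlim_at_infinity_conv_norm_at_top)
    thus ?thesis by (simp add: not_essential_def is_pole_def)
  qed
qed

text \<open>Identity theorem: \<open>g\<close> vanishes on the real line, which accumulates at 0, so
  it cannot avoid the value 0 and must vanish off a sparse set. The conclusion is only local and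
  punctured because values of f at its singularities are arbitrary.\<close>

lemma meromorphic_real_on_reals_cnj:
  assumes f: "f meromorphic_on UNIV" and real: "\<And>x::real. f (of_real x) \<in> \<real>"
  shows "eventually (\<lambda>z. f (cnj z) = cnj (f z)) (at s)"
proof -
  define g where "g z = f z - cnj (f (cnj z))" for z
  have g: "g meromorphic_on UNIV"
    unfolding g_def by (intro meromorphic_intros meromorphic_on_cnj_cnj f)
  have "\<not> eventually (\<lambda>z. g z \<noteq> 0) (at 0)"
  proof
    assume "eventually (\<lambda>z. g z \<noteq> 0) (at 0)"
    moreover have "filterlim (complex_of_real) (at 0) (at 0)"
      unfolding filterlim_at by (auto intro!: tendsto_eq_intros simp: eventually_at_filter)
    ultimately have "eventually (\<lambda>x. g (complex_of_real x) \<noteq> 0) (at 0)"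
      by (rule eventually_compose_filterlim)
    moreover have "g (of_real x) = 0" for x
      using real[of x] by (simp add: g_def Reals_cnj_iff)
    ultimately show False by simp
  qed
  hence "\<not> eventually (\<lambda>z. g z \<noteq> 0) (cosparse UNIV)"
    by (auto simp: eventually_cosparse_open_eq)
  hence "eventually (\<lambda>z. g z = 0) (cosparse UNIV)"
    using meromorphic_imp_constant_or_avoid[OF g, of 0] by auto
  hence "eventually (\<lambda>z. g z = 0) (at s)" by (auto simp: eventually_cosparse_open_eq)
  thus ?thesis by eventually_elim (auto simp: g_def)
qed

section \<open>Meromorphic functions with c(s) c(1 - s) = 1 and real coefficients\<close>

text \<open>The identities are required near each point, not at it: a pole carries the default value
  0, where the product would be 0 instead of 1. Pointwise forms follow by continuity in
  \<open>cnj_eq\<close> and \<open>refl_eq\<close>.\<close>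

locale reflected_meromorphic =
  fixes c :: "complex \<Rightarrow> complex"
  assumes nice: "c nicely_meromorphic_on UNIV"
    and refl_ev: "\<And>s. eventually (\<lambda>z. c z * c (1 - z) = 1) (at s)"
    and cnj_ev: "\<And>s. eventually (\<lambda>z. c (cnj z) = cnj (c z)) (at s)"
begin

lemma analytic_at: "\<not> is_pole c s \<Longrightarrow> c analytic_on {s}"
  using nicely_meromorphic_on_imp_analytic_at[OF nice] by auto

lemma isCont_at: "\<not> is_pole c s \<Longrightarrow> isCont c s"
  using analytic_at analytic_at_imp_isCont by blast

lemma pole_value: "is_pole c s \<Longrightarrow> c s = 0"
  using nice not_tendsto_and_filterlim_at_infinity[of "at s" c]
  by (auto simp: nicely_meromorphic_on_def is_pole_def)

lemma not_pole_critical_line: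
  assumes "Re s = 1/2"
  shows "\<not> is_pole c s"
proof
  assume "is_pole c s"
  hence inf: "filterlim c at_infinity (at s)" by (simp add: is_pole_def)
  have fl: "filterlim (\<lambda>t. s + \<i> * of_real t) (at s) (at (0::real))"
    unfolding filterlim_at
    by (auto intro!: tendsto_eq_intros simp: eventually_at_filter complex_eq_iff)
  have "eventually (\<lambda>z. c z * c (1 - z) = 1 \<and> c (cnj z) = cnj (c z)) (at s)"
    using refl_ev cnj_ev by (rule eventually_conj)
  from eventually_compose_filterlim[OF this fl]
  have "eventually (\<lambda>t. norm (c (s + \<i> * of_real t)) = 1) (at (0::real))"
  proof eventually_elim
    case (elim t)
    have "1 - (s + \<i> * of_real t) = cnj (s + \<i> * of_real t)"
      using assms by (simp add: complex_eq_iff)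
    with elim have "c (s + \<i> * of_real t) * cnj (c (s + \<i> * of_real t)) = 1" by metis
    hence "of_real (norm (c (s + \<i> * of_real t)) ^ 2) = (1 :: complex)"
      using complex_norm_square by (metis)
    hence "norm (c (s + \<i> * of_real t)) ^ 2 = 1" using of_real_eq_1_iff by blast
    thus ?case by (simp add: power2_eq_1_iff norm_ge_zero) (smt (verit) norm_ge_zero)
  qed
  moreover have "filterlim (\<lambda>t. c (s + \<i> * of_real t)) at_infinity (at (0::real))"
    by (rule filterlim_compose[OF inf fl])
  hence "eventually (\<lambda>t. norm (c (s + \<i> * of_real t)) \<ge> 2) (at (0::real))"
    by (simp add: filterlim_at_infinity_conv_norm_at_top filterlim_at_top)
  ultimately have "eventually (\<lambda>t. False) (at (0::real))" by eventually_elim auto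
  thus False by simp
qed

lemma cnj_eq: "\<not> is_pole c s \<Longrightarrow> \<not> is_pole c (cnj s) \<Longrightarrow> c (cnj s) = cnj (c s)"
  by (rule isCont_eventually_eq_at[OF _ _ cnj_ev])
     (auto intro!: continuous_intros isCont_at isCont_o2[where f = cnj and g = c])

lemma isCont_reflect: "\<not> is_pole c (1 - s) \<Longrightarrow> isCont (\<lambda>z. c (1 - z)) s"
  by (rule isCont_o2[where g = c]) (auto intro!: continuous_intros isCont_at)

lemma refl_eq: "\<not> is_pole c s \<Longrightarrow> \<not> is_pole c (1 - s) \<Longrightarrow> c s * c (1 - s) = 1"
  by (rule isCont_eventually_eq_at[where g = "\<lambda>_. 1"])
     (auto intro!: continuous_intros isCont_at isCont_reflect refl_ev)

lemma critical_line:
  assumes "Re s = 1/2"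
  shows critical_line_cnj: "c (1 - s) = cnj (c s)" and critical_line_norm: "norm (c s) = 1"
proof -
  have s: "1 - s = cnj s" using assms by (simp add: complex_eq_iff)
  have np: "\<not> is_pole c s" "\<not> is_pole c (cnj s)"
    using assms by (auto intro!: not_pole_critical_line)
  show 1: "c (1 - s) = cnj (c s)" using cnj_eq np s by simp
  have "c s * cnj (c s) = 1" using refl_eq[of s] np s 1 by simp
  hence "of_real (norm (c s) ^ 2) = (1 :: complex)" by (metis complex_norm_square)
  hence "norm (c s) ^ 2 = 1" using of_real_eq_1_iff by blast
  thus "norm (c s) = 1" by (smt (verit) norm_ge_zero power2_eq_1_iff)
qed

text \<open>Near s, c(1 - z) equals 1/c(z), which has the finite limit 1/c(s).\<close>

lemma reflect_not_pole:
  assumes "\<not> is_pole c s" "c s \<noteq> 0"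
  shows "\<not> is_pole c (1 - s)"
proof
  assume "is_pole c (1 - s)"
  hence "filterlim c at_infinity (at (1 - s))" by (simp add: is_pole_def)
  from filterlim_compose[OF this filterlim_one_minus_at]
  have "filterlim (\<lambda>z. c (1 - z)) at_infinity (at s)" .
  moreover have "((\<lambda>z. 1 / c z) \<longlongrightarrow> 1 / c s) (at s)"
    using isCont_at[OF assms(1)] assms(2) by (intro tendsto_intros) (auto simp: isCont_def)
  hence "((\<lambda>z. c (1 - z)) \<longlongrightarrow> 1 / c s) (at s)"
    by (rule Lim_transform_eventually) (rule eventually_mono[OF refl_ev], auto simp: divide_eq_eq mult.commute)
  ultimately show False
    using not_tendsto_and_filterlim_at_infinity[of "at s" "\<lambda>z. c (1 - z)"] by auto
qed

text \<open>Obtained by differentiating c(z) c(1 - z) = 1. It transports simplicity of zeros of 1 +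
  c or 1 - c across the critical line.\<close>

lemma deriv_reflect:
  assumes "\<not> is_pole c s" "\<not> is_pole c (1 - s)"
  shows "deriv c s * c (1 - s) = c s * deriv c (1 - s)"
proof -
  have d: "(c has_field_derivative deriv c s) (at s)" "(c has_field_derivative deriv c (1 - s)) (at (1 - s))"
    using analytic_at[OF assms(1)] analytic_at[OF assms(2)]
    by (auto simp: DERIV_deriv_iff_field_differentiable analytic_on_imp_differentiable_at)
  have "((\<lambda>z. c z * c (1 - z)) has_field_derivative deriv c s * c (1 - s) + deriv c (1 - s) * (- 1) * c s) (at s)"
    using d by (intro DERIV_mult DERIV_chain2[where f = c]) (auto intro!: derivative_eq_intros)
  moreover have "((\<lambda>z. c z * c (1 - z)) has_field_derivative 0) (at s)"
  proof (rule DERIV_cong_ev[THEN iffD1, OF refl _ refl DERIV_const])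
    show "\<forall>\<^sub>F x in nhds s. 1 = c x * c (1 - x)"
      using refl_ev[of s] refl_eq[OF assms] by (auto simp: eventually_nhds_conv_at elim: eventually_mono)
  qed
  ultimately have "deriv c s * c (1 - s) + deriv c (1 - s) * (- 1) * c s = 0"
    by (rule DERIV_unique)
  thus ?thesis by (simp add: algebra_simps)
qed

lemma simple_pole_limit:
  assumes "is_pole c s" "zorder c s = -1"
  shows "((\<lambda>z. (z - s) * c z) \<longlongrightarrow> residue c s) (at s)"
proof -
  have iso: "isolated_singularity_at c s" and ne: "not_essential c s"
    using nice by (auto simp: nicely_meromorphic_on_def meromorphic_on_altdef)
  have "\<exists>\<^sub>F w in at s. c w \<noteq> 0"
    using non_zero_neighbour_pole[OF assms(1)] by (rule eventually_frequently[OF at_neq_bot])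
  from zorder_exist[OF iso ne this] obtain r where r: "r > 0" "zor_poly c s holomorphic_on cball s r"
     "\<And>w. w \<in> cball s r - {s} \<Longrightarrow> c w = zor_poly c s w * (w - s) powi zorder c s"
    by auto
  have "isCont (zor_poly c s) s"
    using holomorphic_on_imp_continuous_on[OF r(2)] r(1) continuous_on_interior[of "cball s r" _ s] by auto
  hence "(zor_poly c s \<longlongrightarrow> residue c s) (at s)"
    using residue_simple_pole[OF iso assms] by (simp add: isCont_def)
  moreover have "eventually (\<lambda>z. zor_poly c s z = (z - s) * c z) (at s)"
    by (rule eventually_mono[OF eventually_at_in_open[of "ball s r" s]])
       (use r assms in \<open>auto simp: power_int_minus field_simps\<close>)
  ultimately show ?thesis by (rule Lim_transform_eventually)
qed

text \<open>A real point is fixed by conjugation, so approaching it along z and along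
  \<open>cnj z\<close> gives the same limit; hence the residue equals its conjugate.\<close>

lemma residue_real_pole:
  assumes "is_pole c (of_real x)" "zorder c (of_real x) = -1"
  shows "of_real (Re (residue c (of_real x))) = residue c (of_real x)"
proof -
  define R where "R = residue c (of_real x)"
  have lim: "((\<lambda>z. (z - of_real x) * c z) \<longlongrightarrow> R) (at (of_real x))"
    unfolding R_def by (rule simple_pole_limit[OF assms])
  have "((\<lambda>z. (cnj z - of_real x) * c (cnj z)) \<longlongrightarrow> R) (at (of_real x))"
    using filterlim_compose[OF lim, of cnj "at (of_real x)"] filterlim_cnj_at[of "of_real x"] by simp
  hence "((\<lambda>z. cnj ((z - of_real x) * c z)) \<longlongrightarrow> R) (at (of_real x))"
    by (rule Lim_transform_eventually) (use cnj_ev[of "of_real x"] in \<open>eventually_elim, auto\<close>)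
  moreover have "((\<lambda>z. cnj ((z - of_real x) * c z)) \<longlongrightarrow> cnj R) (at (of_real x))"
    using lim by (rule tendsto_cnj)
  ultimately have "cnj R = R" using tendsto_unique[OF at_neq_bot] by blast
  hence "R \<in> \<real>" by (simp add: Reals_cnj_iff)
  thus ?thesis by (simp add: R_def)
qed

end

section \<open>The quotient h(1 - s)/h(s) and its growth\<close>

text \<open>Near every point \<open>c_quot h\<close> agrees with the pointwise quotient, and neither
  h(z) nor h(1 - z) vanishes there off the point itself, since h is not identically 0. The product
  identity is then cancellation.\<close>

lemma reflected_meromorphic_c_quot:
  assumes h: "h nicely_meromorphic_on UNIV" and nz: "\<not> (\<forall>s. h s = 0)"
    and real: "\<And>x::real. h (of_real x) \<in> \<real>"
  shows "reflected_meromorphic (c_quot h)"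
proof
  have hm: "h meromorphic_on UNIV" using h by (simp add: nicely_meromorphic_on_def)
  have h1m: "(\<lambda>s. h (1 - s)) meromorphic_on UNIV"
    by (rule meromorphic_on_compose[OF hm]) (auto intro!: analytic_intros)
  have m: "(\<lambda>s. h (1 - s) / h s) meromorphic_on UNIV"
    by (intro meromorphic_intros hm h1m)
  show "c_quot h nicely_meromorphic_on UNIV"
    unfolding c_quot_def by (rule remove_sings_nicely_meromorphic[OF m])
  have c_ev: "eventually (\<lambda>z. c_quot h z = h (1 - z) / h z) (at s)" for s
    unfolding c_quot_def
    by (rule eventually_remove_sings_eq_at) (use m in \<open>auto simp: meromorphic_on_altdef\<close>)
  have c_ev': "eventually (\<lambda>z. c_quot h (1 - z) = h z / h (1 - z)) (at s)" for s
    using eventually_compose_filterlim[OF c_ev filterlim_one_minus_at, of s] by simp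
  have "eventually (\<lambda>z. h z \<noteq> 0) (cosparse UNIV)"
    using nicely_meromorphic_imp_constant_or_avoid[OF h, of 0] nz by auto
  hence nz_ev: "eventually (\<lambda>z. h z \<noteq> 0) (at s)" for s
    by (auto simp: eventually_cosparse_open_eq)
  have nz_ev': "eventually (\<lambda>z. h (1 - z) \<noteq> 0) (at s)" for s
    by (rule eventually_compose_filterlim[OF nz_ev filterlim_one_minus_at])
  show "eventually (\<lambda>z. c_quot h z * c_quot h (1 - z) = 1) (at s)" for s
    using c_ev c_ev' nz_ev nz_ev' by eventually_elim simp
  have h_cnj: "eventually (\<lambda>z. h (cnj z) = cnj (h z)) (at s)" for s
    by (rule meromorphic_real_on_reals_cnj[OF hm real])
  have h_cnj': "eventually (\<lambda>z. h (1 - cnj z) = cnj (h (1 - z))) (at s)" for s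
    using eventually_compose_filterlim[OF h_cnj filterlim_one_minus_at, of s] by simp
  have c_ev'': "eventually (\<lambda>z. c_quot h (cnj z) = h (1 - cnj z) / h (cnj z)) (at s)" for s
    by (rule eventually_compose_filterlim[OF c_ev filterlim_cnj_at])
  show "eventually (\<lambda>z. c_quot h (cnj z) = cnj (c_quot h z)) (at s)" for s
    using c_ev c_ev'' h_cnj h_cnj' by eventually_elim simp
qed

lemma infinite_half_plane: "infinite {s. Re s > 1/2}"
proof
  assume "finite {s. Re s > 1/2}"
  hence "{s. Re s > 1/2} = {}"
    using finite_imp_not_open open_halfspace_Re_gt by blast
  moreover have "1 \<in> {s. Re s > 1/2}" by simp
  ultimately show False by blast
qed

text \<open>Turns the exponent 1 - \<epsilon> of the growth hypothesis into the o(|w|) form needed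
  to discard the semicircle.\<close>

lemma powr_growth_sublinear:
  assumes "\<epsilon> > 0" "e > 0"
  obtains X :: real where "\<And>x. x \<ge> X \<Longrightarrow> C * x powr (1 - \<epsilon>) \<le> e * x"
proof -
  have "((\<lambda>x. C * x powr (-\<epsilon>)) \<longlongrightarrow> C * 0) at_top"
    using assms by (intro tendsto_intros tendsto_neg_powr filterlim_ident) auto
  hence "eventually (\<lambda>x. C * x powr (-\<epsilon>) < e) at_top"
    using assms by (intro order_tendstoD) auto
  hence "eventually (\<lambda>x. C * x powr (-\<epsilon>) < e \<and> x > 0) at_top"
    using eventually_gt_at_top by (rule eventually_conj)
  then obtain X where X: "\<And>x. x \<ge> X \<Longrightarrow> C * x powr (-\<epsilon>) < e \<and> x > 0"
    by (auto simp: eventually_at_top_linorder)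
  have "C * x powr (1 - \<epsilon>) \<le> e * x" if "x \<ge> X" for x
  proof -
    have "C * x powr (1 - \<epsilon>) = C * x powr (-\<epsilon>) * x"
      using X[OF that] by (simp add: powr_diff powr_minus field_simps)
    also have "\<dots> \<le> e * x" using X[OF that] by (intro mult_right_mono) auto
    finally show ?thesis .
  qed
  thus ?thesis by (rule that)
qed

section \<open>Location and simplicity of the zeros\<close>

context reflected_meromorphic
begin

text \<open>The sign u covers 1 + c and 1 - c at once. Zeros with Re s at least 1/2 come from
  \<open>unimodular_half_plane\<close> applied to u c(w + 1/2); the others are reflected by s -> 1 -
  s.\<close>

lemma reflected_zeros:
  fixes \<sigma> :: "nat \<Rightarrow> real" and n :: nat and u \<epsilon> :: real
  assumes u: "u ^ 2 = 1"
    and largest: "\<And>i. i \<in> {1..n} \<Longrightarrow> \<sigma> i \<le> \<sigma> n"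
    and poles: "\<And>p. Re p > 1/2 \<Longrightarrow> is_pole c p \<Longrightarrow> (\<exists>i\<in>{1..n}. p = of_real (\<sigma> i)) \<and> zorder c p = -1"
    and \<epsilon>: "\<epsilon> > 0"
    and growth: "\<And>\<delta>. \<delta> > 0 \<Longrightarrow> \<exists>C. \<forall>s. Re s \<ge> 1/2 \<and>
           (\<forall>p. Re p \<ge> 1/2 \<and> is_pole c p \<longrightarrow> dist s p \<ge> \<delta>) \<longrightarrow> norm (c s) \<le> C * norm s powr (1 - \<epsilon>)"
    and res: "\<And>i. i \<in> {1..n} \<Longrightarrow> u * Re (residue c (of_real (\<sigma> i))) \<ge> 0"
    and nsq: "\<not> square_integrable_critical_line (\<lambda>s. 1 + of_real u * c s)"
    and zero: "1 + of_real u * c s = 0"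
  shows "(Re s = 1/2 \<or> (n \<ge> 1 \<and> s \<in> of_real ` {1 - \<sigma> n..\<sigma> n})) \<and>
         (s \<noteq> 1/2 \<longrightarrow> zorder (\<lambda>z. 1 + of_real u * c z) s = 1)"
proof -
  have u0: "u \<noteq> 0" and u1: "u = 1 \<or> u = -1" using u by (auto simp: power2_eq_1_iff)
  define P where "P = {p. p > 0 \<and> is_pole c (of_real p + 1/2)}"
  define F where "F w = of_real u * c (w + 1/2)" for w
  define \<rho> where "\<rho> p = u * Re (residue c (of_real p + 1/2))" for p :: real
  have P_\<sigma>: "\<exists>i\<in>{1..n}. p + 1/2 = \<sigma> i" and P_z: "zorder c (of_real p + 1/2) = -1" if "p \<in> P" for p
  proof -
    have "(\<exists>i\<in>{1..n}. of_real p + 1/2 = complex_of_real (\<sigma> i)) \<and> zorder c (of_real p + 1/2) = -1"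
      using that by (intro poles) (auto simp: P_def)
    thus "\<exists>i\<in>{1..n}. p + 1/2 = \<sigma> i" "zorder c (of_real p + 1/2) = -1"
      by (auto simp: complex_eq_iff)
  qed
  \<comment> \<open>The growth hypothesis speaks of poles with Re p at least 1/2; the critical line
    carries none, so all of them come from \<open>P\<close>.\<close>
  have pole_P: "\<exists>q\<in>P. p = of_real q + 1/2" if "is_pole c p" "Re p \<ge> 1/2" for p
  proof -
    have "Re p > 1/2" using that not_pole_critical_line[of p] by linarith
    with poles[OF this that(1)] obtain i where i: "p = of_real (\<sigma> i)" by auto
    hence "\<sigma> i - 1/2 \<in> P" "p = of_real (\<sigma> i - 1/2) + 1/2"
      using that \<open>Re p > 1/2\<close> by (auto simp: P_def)
    thus ?thesis by blast
  qed
  have shift: "filterlim (\<lambda>w. w + 1/2) (at (a + 1/2)) (at a)" for a :: complex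
    unfolding filterlim_at by (auto intro!: tendsto_intros simp: eventually_at_filter)
  have finP: "finite P"
  proof (rule finite_subset)
    show "P \<subseteq> (\<lambda>i. \<sigma> i - 1/2) ` {1..n}" using P_\<sigma> by force
  qed auto
  interpret unimodular_half_plane F P \<rho>
  proof
    show "finite P" by (rule finP)
    show "p > 0" if "p \<in> P" for p using that by (simp add: P_def)
    show "\<rho> p \<ge> 0" if p: "p \<in> P" for p
    proof -
      obtain i where i: "i \<in> {1..n}" "p + 1/2 = \<sigma> i" using P_\<sigma>[OF p] by blast
      have "complex_of_real p + 1/2 = of_real (\<sigma> i)" by (simp flip: i(2))
      thus ?thesis using res[OF i(1)] by (simp add: \<rho>_def)
    qed
    show "F analytic_on {w}" if "Re w \<ge> 0" "w \<notin> of_real ` P" for w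
    proof -
      have "\<not> is_pole c (w + 1/2)" using pole_P[of "w + 1/2"] that by auto
      hence "c analytic_on {w + 1/2}" by (rule analytic_at)
      hence "c \<circ> (\<lambda>w. w + 1/2) analytic_on {w}"
        by (intro analytic_on_compose) (auto intro!: analytic_intros)
      thus ?thesis unfolding F_def o_def by (intro analytic_intros)
    qed
    show "((\<lambda>w. (w - of_real p) * F w) \<longlongrightarrow> of_real (\<rho> p)) (at (of_real p))" if "p \<in> P" for p
    proof -
      have pole: "is_pole c (of_real p + 1/2)" using that by (simp add: P_def)
      have *: "complex_of_real (p + 1/2) = of_real p + 1/2" by simp
      have "((\<lambda>w. (w + 1/2 - (of_real p + 1/2)) * c (w + 1/2)) \<longlongrightarrow> residue c (of_real p + 1/2)) (at (of_real p))"
        by (rule filterlim_compose[OF simple_pole_limit[OF pole P_z[OF that]] shift])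
      hence "((\<lambda>w. of_real u * ((w + 1/2 - (of_real p + 1/2)) * c (w + 1/2))) \<longlongrightarrow>
               of_real u * residue c (of_real p + 1/2)) (at (of_real p))"
        by (rule tendsto_mult_left)
      moreover have "of_real u * residue c (of_real p + 1/2) = of_real (\<rho> p)"
        using residue_real_pole[of "p + 1/2"] pole P_z[OF that] unfolding * \<rho>_def by simp
      ultimately show ?thesis by (simp add: F_def mult_ac)
    qed
    show "\<exists>r. \<forall>w. 0 \<le> Re w \<and> r \<le> cmod w \<longrightarrow> cmod (F w) \<le> e * cmod w" if "e > 0" for e
    proof -
      obtain C where C: "\<And>s. Re s \<ge> 1/2 \<Longrightarrow> (\<And>p. Re p \<ge> 1/2 \<Longrightarrow> is_pole c p \<Longrightarrow> dist s p \<ge> 1) \<Longrightarrow>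
           norm (c s) \<le> C * norm s powr (1 - \<epsilon>)"
        using growth[OF zero_less_one] by metis
      obtain X where X: "\<And>x. x \<ge> X \<Longrightarrow> C * x powr (1 - \<epsilon>) \<le> e / 2 * x"
        using powr_growth_sublinear[OF \<epsilon>, of "e / 2" C] \<open>e > 0\<close> by auto
      \<comment> \<open>Beyond \<open>r\<close> every pole is at distance at least 1, matching the
        choice \<delta> = 1 for \<open>C\<close>. The e/2 in \<open>X\<close> compensates |w + 1/2|
        being at most 2 |w|.\<close>
      define r where "r = Max (insert 1 (insert X ((\<lambda>p. p + 1) ` P)))"
      have "norm (F w) \<le> e * norm w" if w: "Re w \<ge> 0" "norm w \<ge> r" for w
      proof -
        have w1: "norm w \<ge> 1" "norm w \<ge> X" and w2: "\<And>p. p \<in> P \<Longrightarrow> norm w \<ge> p + 1"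
          using w finP by (auto simp: r_def)
        have far: "dist (w + 1/2) p \<ge> 1" if p: "Re p \<ge> 1/2" "is_pole c p" for p
        proof -
          obtain q where q: "q \<in> P" "p = of_real q + 1/2" using pole_P p by blast
          hence "q > 0" by (simp add: P_def)
          have "1 \<le> norm w - norm (complex_of_real q)" using w2[OF q(1)] \<open>q > 0\<close> by simp
          also have "\<dots> \<le> norm (w - of_real q)" by (rule norm_triangle_ineq2)
          finally show ?thesis by (simp add: q dist_norm)
        qed
        have "norm w \<le> norm (w + 1/2)"
          unfolding cmod_def using w by (simp add: power_mono)
        hence le: "X \<le> norm (w + 1/2)" using w1 by simp
        have "norm (w + 1/2) \<le> norm w + 1/2"
          by (rule order.trans[OF norm_triangle_ineq]) simp
        hence le2: "norm (w + 1/2) \<le> 2 * norm w" using w1 by simp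
        have "norm (F w) = norm (c (w + 1/2))" using u1 by (auto simp: F_def)
        also have "\<dots> \<le> C * norm (w + 1/2) powr (1 - \<epsilon>)" using w far by (intro C) auto
        also have "\<dots> \<le> e / 2 * norm (w + 1/2)" by (rule X[OF le])
        also have "\<dots> \<le> e / 2 * (2 * norm w)" using le2 \<open>e > 0\<close> by (intro mult_left_mono) auto
        finally show ?thesis by simp
      qed
      thus ?thesis by blast
    qed
    have line: "- \<i> * of_real t + 1/2 = 1 - (\<i> * of_real t + 1/2)" for t by simp
    show "F (- \<i> * of_real t) = cnj (F (\<i> * of_real t))" for t
      using critical_line_cnj[of "\<i> * of_real t + 1/2"] unfolding F_def line by simp
    show "norm (F (\<i> * of_real t)) = 1" for t
      using critical_line_norm[of "\<i> * of_real t + 1/2"] u1 by (auto simp: F_def)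
    \<comment> \<open>The failure of square integrability enters here: the zero function is
      square-integrable.\<close>
    show "\<exists>t. 1 + F (\<i> * of_real t) \<noteq> 0"
    proof (rule ccontr)
      assume "\<nexists>t. 1 + F (\<i> * of_real t) \<noteq> 0"
      hence "1 + of_real u * c (Complex (1/2) t) = 0" for t
        by (simp add: F_def Complex_eq add.commute)
      hence "square_integrable_critical_line (\<lambda>s. 1 + of_real u * c s)"
        by (simp add: square_integrable_critical_line_def)
      with nsq show False by simp
    qed
  qed
  have right: "(Re s = 1/2 \<or> (n \<ge> 1 \<and> s \<in> of_real ` {1/2..\<sigma> n})) \<and> (s \<noteq> 1/2 \<longrightarrow> deriv c s \<noteq> 0)"
    if s: "1 + of_real u * c s = 0" "Re s \<ge> 1/2" for s
  proof -
    define w where "w = s - 1/2"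
    \<comment> \<open>At a pole the default value c s = 0 gives 1 + u c s = 1, so the equation
      excludes poles.\<close>
    have np: "\<not> is_pole c s" using pole_value[of s] s by auto
    have sw: "s = w + 1/2" by (simp add: w_def)
    have wP: "w \<notin> of_real ` P" using np by (auto simp: sw P_def)
    have w0: "Re w \<ge> 0" "1 + F w = 0" using s by (simp_all add: F_def w_def)
    have "n \<ge> 1 \<and> s \<in> of_real ` {1/2..\<sigma> n}" if off_line: "Re s \<noteq> 1/2"
    proof -
      obtain p where p: "Im w = 0" "p \<in> P" "Re w \<le> p"
        using zero_location[OF w0(1) wP w0(2)] off_line by (auto simp: w_def)
      obtain i where i: "i \<in> {1..n}" "p + 1/2 = \<sigma> i" using P_\<sigma>[OF p(2)] by blast
      have "Re s \<le> \<sigma> n" using i largest[OF i(1)] p by (simp add: w_def)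
      moreover have "s = of_real (Re s)" using p by (simp add: w_def complex_eq_iff)
      ultimately show ?thesis using i s by (auto intro!: image_eqI[of _ _ "Re s"])
    qed
    moreover have "deriv c s \<noteq> 0" if "s \<noteq> 1/2"
    proof
      assume "deriv c s = 0"
      hence "(c has_field_derivative 0) (at (w + 1/2))"
        using analytic_at[OF np]
        by (metis sw DERIV_deriv_iff_field_differentiable analytic_on_imp_differentiable_at insertI1)
      hence "(F has_field_derivative of_real u * (0 * 1)) (at w)"
        unfolding F_def
        by (intro DERIV_cmult DERIV_chain2[where f = c]) (auto intro!: derivative_eq_intros)
      hence "deriv F w = 0" by (simp add: DERIV_imp_deriv)
      thus False using zero_simple[OF w0(1) wP w0(2)] that by (simp add: w_def)
    qed
    ultimately show ?thesis by blast
  qed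
  have np: "\<not> is_pole c s" using pole_value[of s] zero by auto
  have main: "(Re s = 1/2 \<or> (n \<ge> 1 \<and> s \<in> of_real ` {1 - \<sigma> n..\<sigma> n})) \<and> (s \<noteq> 1/2 \<longrightarrow> deriv c s \<noteq> 0)"
  proof (cases "Re s \<ge> 1/2")
    case True
    thus ?thesis using right[OF zero True] by auto
  next
    case False
    \<comment> \<open>As u^2 = 1, the value -u is its own inverse, so c(1 - s) = -u too, and 1 - s
      is a zero in the right half-plane.\<close>
    have cs: "c s = - of_real u" using zero u1 by (auto simp: add_eq_0_iff)
    hence np': "\<not> is_pole c (1 - s)" using reflect_not_pole[OF np] u0 by simp
    have cs': "c (1 - s) = - of_real u"
      using refl_eq[OF np np'] cs u1 by (auto simp: minus_equation_iff)
    have "1 + of_real u * c (1 - s) = 0" using u1 by (auto simp: cs')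
    moreover have "Re (1 - s) \<ge> 1/2" using False by simp
    ultimately have r: "Re (1 - s) = 1/2 \<or> (n \<ge> 1 \<and> 1 - s \<in> of_real ` {1/2..\<sigma> n})"
      "1 - s \<noteq> 1/2 \<longrightarrow> deriv c (1 - s) \<noteq> 0" using right by blast+
    have "1 - s \<noteq> 1/2"
    proof
      assume "1 - s = 1/2"
      hence "Re (1 - s) = Re (1/2)" by (rule arg_cong)
      thus False using False by simp
    qed
    hence "deriv c s \<noteq> 0" using deriv_reflect[OF np np'] r(2) cs cs' u0 by auto
    moreover from r(1) False obtain x where x: "n \<ge> 1" "1 - s = of_real x" "1/2 \<le> x" "x \<le> \<sigma> n" by auto
    hence "s = of_real (1 - x)" by (simp add: algebra_simps)
    with x have "s \<in> of_real ` {1 - \<sigma> n..\<sigma> n}" by (intro image_eqI[of _ _ "1 - x"]) auto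
    ultimately show ?thesis using x by blast
  qed
  moreover have "zorder (\<lambda>z. 1 + of_real u * c z) s = 1" if "deriv c s \<noteq> 0"
  proof -
    obtain S where S: "open S" "s \<in> S" "c holomorphic_on S"
      using analytic_at[OF np] by (auto simp: Complex_Analysis_Basics.analytic_at)
    have "(c has_field_derivative deriv c s) (at s)"
      using S holomorphic_derivI by blast
    hence "((\<lambda>z. 1 + of_real u * c z) has_field_derivative of_real u * deriv c s) (at s)"
      by (auto intro!: derivative_eq_intros)
    hence "deriv (\<lambda>z. 1 + of_real u * c z) s = of_real u * deriv c s"
      by (rule DERIV_imp_deriv)
    thus ?thesis using S zero that u0
      by (intro zorder_zero_eqI[where S = S]) (auto intro!: holomorphic_intros)
  qed
  ultimately show ?thesis by blast
qed

end

theorem theorem2: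
  fixes h :: "complex \<Rightarrow> complex" and n :: nat and \<sigma> :: "nat \<Rightarrow> real" and \<epsilon> :: real
  assumes h_mero: "h nicely_meromorphic_on UNIV"
    and h_zeros: "{s. Re s > 1/2 \<and> mero_zero h s} = (\<lambda>i. complex_of_real (\<sigma> i)) ` {1..n}"
    and \<sigma>_n_largest: "\<forall>i\<in>{1..n}. \<sigma> i \<le> \<sigma> n"
    and h_real: "\<forall>x::real. h (complex_of_real x) \<in> \<real>"
    and c_poles: "\<forall>p. Re p > 1/2 \<and> is_pole (c_quot h) p \<longrightarrow>
           (\<exists>i\<in>{1..n}. p = complex_of_real (\<sigma> i)) \<and> zorder (c_quot h) p = -1"
    and \<epsilon>_pos: "\<epsilon> > 0"
    and c_growth: "\<forall>\<delta>>0. \<exists>C. \<forall>s. Re s \<ge> 1/2 \<and>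
           (\<forall>p. Re p \<ge> 1/2 \<and> is_pole (c_quot h) p \<longrightarrow> dist s p \<ge> \<delta>) \<longrightarrow>
           cmod (c_quot h s) \<le> C * cmod s powr (1 - \<epsilon>)"
  shows "((\<forall>i\<in>{1..n}. Re (residue (c_quot h) (complex_of_real (\<sigma> i))) \<ge> 0) \<and>
          \<not> square_integrable_critical_line (\<lambda>s. 1 + c_quot h s) \<longrightarrow>
          (\<forall>s. mero_zero (\<lambda>z. 1 + c_quot h z) s \<and>
               \<not> (mero_zero h s \<and> mero_zero (\<lambda>z. h (1 - z)) s) \<longrightarrow>
               (Re s = 1/2 \<or> (n \<ge> 1 \<and> s \<in> complex_of_real ` {1 - \<sigma> n..\<sigma> n})) \<and>
               (s \<noteq> 1/2 \<longrightarrow> zorder (\<lambda>z. 1 + c_quot h z) s = 1)))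
       \<and> ((\<forall>i\<in>{1..n}. Re (residue (c_quot h) (complex_of_real (\<sigma> i))) \<le> 0) \<and>
          \<not> square_integrable_critical_line (\<lambda>s. 1 - c_quot h s) \<longrightarrow>
          (\<forall>s. mero_zero (\<lambda>z. 1 - c_quot h z) s \<and>
               \<not> (mero_zero h s \<and> mero_zero (\<lambda>z. h (1 - z)) s) \<longrightarrow>
               (Re s = 1/2 \<or> (n \<ge> 1 \<and> s \<in> complex_of_real ` {1 - \<sigma> n..\<sigma> n})) \<and>
               (s \<noteq> 1/2 \<longrightarrow> zorder (\<lambda>z. 1 - c_quot h z) s = 1)))"
proof -
  \<comment> \<open>Otherwise every point of the half-plane Re s > 1/2 would be a zero, but
    \<open>h_zeros\<close> makes that set finite.\<close>
  have "\<not> (\<forall>s. h s = 0)"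
  proof
    assume "\<forall>s. h s = 0"
    hence "h = (\<lambda>_. 0)" by auto
    hence "{s. Re s > 1/2 \<and> mero_zero h s} = {s. Re s > 1/2}" by (auto simp: mero_zero_def)
    thus False using h_zeros infinite_half_plane by auto
  qed
  then interpret reflected_meromorphic "c_quot h"
    using h_mero h_real by (intro reflected_meromorphic_c_quot) auto
  have zeros: "(Re s = 1/2 \<or> (n \<ge> 1 \<and> s \<in> complex_of_real ` {1 - \<sigma> n..\<sigma> n})) \<and>
         (s \<noteq> 1/2 \<longrightarrow> zorder (\<lambda>z. 1 + of_real u * c_quot h z) s = 1)"
    if "u ^ 2 = 1" "\<And>i. i \<in> {1..n} \<Longrightarrow> u * Re (residue (c_quot h) (of_real (\<sigma> i))) \<ge> 0"
       "\<not> square_integrable_critical_line (\<lambda>s. 1 + of_real u * c_quot h s)"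
       "1 + of_real u * c_quot h s = 0" for u s
    using that(1) \<sigma>_n_largest c_poles \<epsilon>_pos c_growth that(2-)
    by (intro reflected_zeros[of u n \<sigma> \<epsilon>]) auto
  show ?thesis
    using zeros[of 1] zeros[of "-1"] by (simp add: mero_zero_def)
qed

end
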